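(* Let $(\mathcal{G}_1,e_1,f_1)$ and $(\mathcal{G}_2,e_2,f_2)$ be birooted graphs, and let $\mu_1,\mu_2,\nu_2$ be the spectral distributions of $(\mathcal{G}_1,e_1)$, $(\mathcal{G}_2,e_2)$ and $(\mathcal{G}_2,f_2)$, respectively. Then the spectral distribution of $(\mathcal{G}_1\vartriangleright_{f_2}\mathcal{G}_2,e)$ is the c-monotone additive convolution $\mu=\mu_1\vartriangleright_{\nu_2}\mu_2$, whose reciprocal Cauchy transform is given by $$F_{\mu}(z)=F_{\mu_1}(F_{\nu_2}(z))+F_{\mu_2}(z)-F_{\nu_2}(z),$$ where $F_\mu(z)=1/G_\mu(z)$ and $G_\mu(z)=\sum_{n=0}^{\infty}M_nz^{-n-1}$, with $M_n$ the $n$-th moment of $\mu$ (equal to the number of walks of length $n$ from the root to the root).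
   Context: Graphs are non-oriented, uniformly locally finite (vertex degrees uniformly bounded), possibly disconnected with finitely many components, and may have loops. A birooted graph $(\mathcal{G},e,f)$ is a graph with two distinguished vertices $e,f$ (roots; allowed to coincide). The adjacency matrix $a(\mathcal{G})$ acts on $\ell^2(V)$ ($V$ the vertex set) and its $(x,y)$ entry is the number of edges joining $x$ and $y$ (each loop counted once). The spectral distribution of a rooted graph $(\mathcal{G},e)$ is the distribution $\mu$ with moments $M_n=\langle a(\mathcal{G})^n\delta(e),\delta(e)\rangle$, where $\delta(e)$ is the basis vector at $e$. The graph $\mathcal{G}_1\vartriangleright_{f_2}\mathcal{G}_2=(\mathcal{G}_1,e_1)\vartriangleright_{f_2}(\mathcal{G}_2,e_2)$ is the rooted graph obtained by attaching (gluing) a copy of $\mathcal{G}_2$ by its vertex $e_2$ to the root $e_1$ of $\mathcal{G}_1$, and a copy of $\mathcal{G}_2$ by its vertex $f_2$ to each of the remaining vertices of $\mathcal{G}_1$; all edges of $\mathcal{G}_1$ and of all copies of $\mathcal{G}_2$ are kept; the root $e$ is the vertex obtained by identifying $e_1$ with $e_2$ in the copy attached there. The c-monotone additive convolution (Hasebe) $\mu_1\vartriangleright_{\nu_2}\mu_2$ is the distribution whose reciprocal Cauchy transform is $F_{\mu_1}(F_{\nu_2}(z))+F_{\mu_2}(z)-F_{\nu_2}(z)$. For every distribution $\mu$, $G_\mu$ denotes its Cauchy transform and $F_\mu=1/G_\mu$. *)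

theory Defs
  imports "HOL-Probability.Probability"
begin

section \<open>Non-oriented multigraphs with loops\<close>

text \<open>Every edge carries its set of end points, which has two elements, or one if the edge is a
  loop. Parallel edges are distinct elements of type \<^typ>\<open>'e\<close> with the same ends.\<close>

record ('v, 'e) multigraph =
  verts :: "'v set"
  edges :: "'e set"
  ends :: "'e \<Rightarrow> 'v set"

definition adj_rel :: "('v, 'e) multigraph \<Rightarrow> ('v \<times> 'v) set" where
  "adj_rel G = {(x, y). \<exists>d\<in>edges G. ends G d = {x, y}}"

definition components :: "('v, 'e) multigraph \<Rightarrow> 'v set set" where
  "components G = verts G // {(x, y). x \<in> verts G \<and> y \<in> verts G \<and> (x, y) \<in> (adj_rel G)\<^sup>*}"

locale ulf_graph =
  fixes G :: "('v, 'e) multigraph"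
  assumes ends_verts: "\<And>d. d \<in> edges G \<Longrightarrow> \<exists>x\<in>verts G. \<exists>y\<in>verts G. ends G d = {x, y}"
    and unif_loc_finite:
      "\<exists>D. \<forall>x\<in>verts G. finite {d \<in> edges G. x \<in> ends G d} \<and> card {d \<in> edges G. x \<in> ends G d} \<le> D"
    and finite_components: "finite (components G)"

locale birooted_graph = ulf_graph G for G :: "('v, 'e) multigraph" +
  fixes e f :: 'v
  assumes root_e: "e \<in> verts G" and root_f: "f \<in> verts G"

fun walk :: "('v, 'e) multigraph \<Rightarrow> 'v \<Rightarrow> ('e \<times> 'v) list \<Rightarrow> 'v \<Rightarrow> bool" where
  "walk G x [] y \<longleftrightarrow> x \<in> verts G \<and> x = y"
| "walk G x ((d, z) # p) y \<longleftrightarrow> d \<in> edges G \<and> ends G d = {x, z} \<and> walk G z p y"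

section \<open>The adjacency matrix on square-summable functions\<close>

definition adj_matrix :: "('v, 'e) multigraph \<Rightarrow> 'v \<Rightarrow> 'v \<Rightarrow> nat" where
  "adj_matrix G x y = card {d \<in> edges G. ends G d = {x, y}}"

text \<open>Vectors indexed by the vertex set \<open>V\<close> are complex functions vanishing outside \<open>V\<close>.
  For a uniformly locally finite graph, the inner sum has only finitely many nonzero terms, and
  \<open>adj_op\<close> is bounded on the square-summable functions.\<close>

definition adj_op :: "('v, 'e) multigraph \<Rightarrow> ('v \<Rightarrow> complex) \<Rightarrow> ('v \<Rightarrow> complex)" where
  "adj_op G g = (\<lambda>x. if x \<in> verts G then \<Sum>\<^sub>\<infinity>y\<in>verts G. of_nat (adj_matrix G x y) * g y else 0)"

definition basis_vec :: "'v \<Rightarrow> 'v \<Rightarrow> complex" where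
  "basis_vec e = (\<lambda>x. if x = e then 1 else 0)"

definition l2_inner :: "'v set \<Rightarrow> ('v \<Rightarrow> complex) \<Rightarrow> ('v \<Rightarrow> complex) \<Rightarrow> complex" where
  "l2_inner V g h = (\<Sum>\<^sub>\<infinity>x\<in>V. g x * cnj (h x))"

text \<open>For a uniformly locally finite graph these moments grow at most geometrically, so they
  determine the probability measure.\<close>

definition spectral_distribution :: "('v, 'e) multigraph \<Rightarrow> 'v \<Rightarrow> real measure \<Rightarrow> bool" where
  "spectral_distribution G e \<mu> \<longleftrightarrow>
     real_distribution \<mu> \<and>
     (\<forall>n. integrable \<mu> (\<lambda>x. x ^ n) \<and>
          complex_of_real (\<integral>x. x ^ n \<partial>\<mu>) =
            l2_inner (verts G) ((adj_op G ^^ n) (basis_vec e)) (basis_vec e))"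

section \<open>Gluing\<close>

text \<open>The copy of \<open>G2\<close> attached at the vertex \<open>x\<close> of \<open>G1\<close> has vertices \<open>(x, y)\<close> with
  \<open>y\<close> a vertex of \<open>G2\<close>. The vertex \<open>x\<close> of \<open>G1\<close> itself is identified with \<open>(x, e2)\<close> if
  \<open>x = e1\<close>, and with \<open>(x, f2)\<close> otherwise. The root of the glued graph is \<open>(e1, e2)\<close>.\<close>

definition glue :: "('v1, 'e1) multigraph \<Rightarrow> 'v1 \<Rightarrow> ('v2, 'e2) multigraph \<Rightarrow> 'v2 \<Rightarrow> 'v2 \<Rightarrow>
    ('v1 \<times> 'v2, 'e1 + 'v1 \<times> 'e2) multigraph" where
  "glue G1 e1 G2 e2 f2 =
     \<lparr>verts = verts G1 \<times> verts G2,
      edges = edges G1 <+> verts G1 \<times> edges G2,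
      ends = case_sum (\<lambda>d. (\<lambda>x. (x, if x = e1 then e2 else f2)) ` ends G1 d)
                      (\<lambda>(x, d). Pair x ` ends G2 d)\<rparr>"

section \<open>Cauchy transforms and the c-monotone convolution\<close>

definition cauchy_transform :: "real measure \<Rightarrow> complex \<Rightarrow> complex" where
  "cauchy_transform \<mu> z = (\<integral>x. 1 / (z - complex_of_real x) \<partial>\<mu>)"

definition recip_cauchy :: "real measure \<Rightarrow> complex \<Rightarrow> complex" where
  "recip_cauchy \<mu> z = 1 / cauchy_transform \<mu> z"

text \<open>A probability measure on the real line is determined by its Cauchy transform on the upper
  half-plane, and \<open>recip_cauchy \<nu>\<close> maps the upper half-plane into itself.\<close>

definition c_monotone_conv :: "real measure \<Rightarrow> real measure \<Rightarrow> real measure \<Rightarrow> real measure" where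
  "c_monotone_conv \<mu>1 \<nu>2 \<mu>2 =
     (THE \<mu>. real_distribution \<mu> \<and>
        (\<forall>z. Im z > 0 \<longrightarrow>
           recip_cauchy \<mu> z
             = recip_cauchy \<mu>1 (recip_cauchy \<nu>2 z) + recip_cauchy \<mu>2 z - recip_cauchy \<nu>2 z))"

end

theory Submission
  imports Defs "HOL-Complex_Analysis.Complex_Analysis" "HOL-Real_Asymp.Real_Asymp"
begin

text \<open>
  The formula is a statement about resolvents. Let \<open>A\<close> be the adjacency operator of a graph and
  \<open>g z = \<langle>(z - A)\<^sup>-\<^sup>1 \<delta>, \<delta>\<rangle>\<close> at its root, so that \<open>F = 1 / g\<close>. To solve
  \<open>(z - A) u = \<delta>\<close> on the glued graph, look at one copy of the second graph, the one attached at
  \<open>x\<close>. It is joined to the rest only through its gluing vertex, so \<open>u\<close> restricted to it is a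
  multiple of the resolvent vector of the second graph at \<open>e2\<close> (if \<open>x = e1\<close>) or at \<open>f2\<close>
  (otherwise). If \<open>h x\<close> is the value of \<open>u\<close> at the gluing vertex, that multiple is
  \<open>h x * F\<^sub>x\<close>, with \<open>F\<^sub>x\<close> equal to \<open>F\<^bsub>\<mu>2\<^esub> z\<close> or to \<open>F\<^bsub>\<nu>2\<^esub> z\<close>, and the equation at the gluing
  vertices becomes \<open>F\<^sub>x h = A\<^sub>1 h + \<delta>\<close>: a resolvent equation of the first graph at the point
  \<open>F\<^bsub>\<nu>2\<^esub> z\<close>, perturbed in the single site \<open>e1\<close>. Solving this rank one perturbation gives
  \<open>1 / h e1 = F\<^bsub>\<mu>1\<^esub> (F\<^bsub>\<nu>2\<^esub> z) + F\<^bsub>\<mu>2\<^esub> z - F\<^bsub>\<nu>2\<^esub> z\<close>.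

  For \<open>|z|\<close> larger than the degrees no Hilbert space is needed: the neighbour sum operator is
  bounded on bounded functions, the resolvent vector is the Neumann series whose coefficients count
  walks (\<open>green\<close>), and it is the only bounded solution of its equation (\<open>green_unique\<close>). The
  computation above is \<open>green_glue\<close>, and it yields the formula near infinity.

  The convolution is, however, defined through the upper half-plane and through uniqueness. Three
  analytic facts connect the two. First, the glued graph has a spectral distribution
  (\<open>exists_spectral_distribution\<close>): its adjacency operator is symmetric and bounded, so after an
  affine change of variable its moments form a solvable Hausdorff moment problem. Second, both sides
  of the formula are holomorphic on the upper half-plane, so the identity near infinity spreads to
  all of it. Third, a probability measure on the line is determined by its Cauchy transform there
  (\<open>cauchy_transform_unique\<close>, by Stieltjes inversion), so this spectral distribution is the
  convolution. The moments are bounded by powers of the degree bound, which forces compact support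
  and makes the moment series converge to the Cauchy transform near infinity.
\<close>

section \<open>Hausdorff's moment problem\<close>

lemma sum_binomial_Suc:
  fixes g :: "nat \<Rightarrow> real"
  shows "(\<Sum>k\<le>Suc n. (Suc n choose k) * g k)
    = (\<Sum>k\<le>n. (n choose k) * g k) + (\<Sum>k\<le>n. (n choose k) * g (Suc k))"
proof -
  have "(\<Sum>k\<le>Suc n. (Suc n choose k) * g k)
      = (g 0 + (\<Sum>k\<le>n. (n choose Suc k) * g (Suc k))) + (\<Sum>k\<le>n. (n choose k) * g (Suc k))"
    by (simp add: sum.atMost_Suc_shift sum.distrib algebra_simps del: sum.atMost_Suc)
  also have "g 0 + (\<Sum>k\<le>n. (n choose Suc k) * g (Suc k)) = (\<Sum>k\<le>Suc n. (n choose k) * g k)"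
    by (simp add: sum.atMost_Suc_shift del: sum.atMost_Suc)
  also have "\<dots> = (\<Sum>k\<le>n. (n choose k) * g k)" by simp
  finally show ?thesis .
qed

text \<open>Repeated absorption \<open>k (n choose k) = n (n - 1 choose k - 1)\<close>: a falling factorial of the
  summation index turns into one of \<open>n + m\<close>. For binomial weights this is the formula for the
  factorial moments.\<close>

lemma sum_binomial_falling:
  fixes g :: "nat \<Rightarrow> real"
  shows "(\<Sum>k\<le>n + m. (n + m choose k) * (\<Prod>i<m. real k - real i) * g k)
    = (\<Prod>i<m. real (n + m) - real i) * (\<Sum>k\<le>n. (n choose k) * g (k + m))"
proof (induction m arbitrary: g)
  case (Suc m)
  have absorb: "real (Suc (n + m) choose Suc k) * real (Suc k) = real (Suc (n + m)) * real (n + m choose k)" for k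
    using Suc_times_binomial[of k "n + m"] by (metis mult.commute of_nat_mult)
  have "(\<Sum>k\<le>Suc (n + m). (Suc (n + m) choose k) * (\<Prod>i<Suc m. real k - real i) * g k)
      = (\<Sum>k\<le>n + m. (Suc (n + m) choose Suc k) * (\<Prod>i<Suc m. real (Suc k) - real i) * g (Suc k))"
  proof -
    have "(\<Prod>i<Suc m. real 0 - real i) = 0" by (rule prod_zero) auto
    then show ?thesis
      by (subst sum.atMost_Suc_shift) (simp only: mult_zero_left mult_zero_right add_0_left)
  qed
  also have "\<dots> = (\<Sum>k\<le>n + m. real (Suc (n + m))
      * ((n + m choose k) * (\<Prod>i<m. real k - real i) * g (Suc k)))"
  proof (rule sum.cong[OF refl])
    fix k
    have "(\<Prod>i<Suc m. real (Suc k) - real i) = real (Suc k) * (\<Prod>i<m. real k - real i)"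
      by (subst prod.lessThan_Suc_shift) simp
    then have "(Suc (n + m) choose Suc k) * (\<Prod>i<Suc m. real (Suc k) - real i) * g (Suc k)
      = (real (Suc (n + m) choose Suc k) * real (Suc k)) * (\<Prod>i<m. real k - real i) * g (Suc k)"
      by (simp only: mult.assoc)
    also have "\<dots> = real (Suc (n + m)) * ((n + m choose k) * (\<Prod>i<m. real k - real i) * g (Suc k))"
      by (simp only: absorb mult.assoc)
    finally show "(Suc (n + m) choose Suc k) * (\<Prod>i<Suc m. real (Suc k) - real i) * g (Suc k)
      = real (Suc (n + m)) * ((n + m choose k) * (\<Prod>i<m. real k - real i) * g (Suc k))" .
  qed
  also have "\<dots> = real (Suc (n + m)) * ((\<Prod>i<m. real (n + m) - real i)
      * (\<Sum>k\<le>n. (n choose k) * g (Suc (k + m))))"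
    by (simp only: sum_distrib_left[symmetric] Suc.IH)
  also have "\<dots> = (\<Prod>i<Suc m. real (Suc (n + m)) - real i) * (\<Sum>k\<le>n. (n choose k) * g (Suc (k + m)))"
    by (subst prod.lessThan_Suc_shift) simp
  finally show ?case by simp
qed simp

text \<open>Powers of \<open>k / n\<close> and normalised falling factorials of \<open>k\<close> agree up to \<open>O(1 / n)\<close>,
  uniformly in \<open>k\<close>, because they are products of the same number of factors of modulus at most one
  that agree pairwise to that order.\<close>

lemma abs_power_ratio_falling_le:
  fixes k n m :: nat
  assumes "k \<le> n" "2 * m < n"
  shows "\<bar>(k / n) ^ m - (\<Prod>i<m. (real k - real i) / (real n - real i))\<bar> \<le> m * (m / (real n - m))"
proof -
  have "\<bar>(\<Prod>i<m. real k / real n) - (\<Prod>i<m. (real k - real i) / (real n - real i))\<bar>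
      \<le> (\<Sum>i<m. norm (real k / real n - (real k - real i) / (real n - real i)))"
    unfolding real_norm_def[symmetric]
  proof (rule norm_prod_diff)
    fix i assume "i \<in> {..<m}"
    then have "\<bar>real k - real i\<bar> \<le> real n - real i" "0 < real n - real i" using assms by auto
    then show "norm ((real k - real i) / (real n - real i)) \<le> 1" by simp
  qed (use assms in simp)
  also have "\<dots> \<le> (\<Sum>i<m. m / (real n - m))"
  proof (rule sum_mono)
    fix i assume i: "i \<in> {..<m}"
    have pos: "0 < real n - real i" "0 < real n - real m" "0 < real n" using assms i by auto
    have "real k / real n - (real k - real i) / (real n - real i)
        = (i * (1 - k / n)) / (real n - real i)"
      using pos by (simp add: field_simps)
    moreover have "0 \<le> 1 - k / n" "1 - k / n \<le> 1" using assms pos by simp_all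
    then have "0 \<le> i * (1 - k / n)" "i * (1 - k / n) \<le> m"
      using i mult_mono[of "real i" "real m" "1 - k / n" 1] by simp_all
    ultimately show "norm (real k / real n - (real k - real i) / (real n - real i)) \<le> m / (real n - m)"
      using pos i by (auto intro!: frac_le)
  qed
  finally show ?thesis by simp
qed

text \<open>Think of \<open>c k j\<close> as the integral of \<open>x ^ k * (1 - x) ^ j\<close>. The numbers
  \<open>(n choose k) * c k (n - k)\<close> are then the integrals of the Bernstein basis polynomials; they
  are nonnegative and add up to one. Put these masses at the points \<open>k / n\<close>. The factorial
  moments of the resulting measures can be computed exactly, hence the moments converge to
  \<open>c m 0\<close>, and a weak limit point of the measures, which exists by Helly's theorem, is a
  solution.\<close>

theorem hausdorff_moment_problem:
  fixes c :: "nat \<Rightarrow> nat \<Rightarrow> real"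
  assumes nonneg: "\<And>k j. 0 \<le> c k j"
    and pascal: "\<And>k j. c k j = c (Suc k) j + c k (Suc j)"
    and total: "c 0 0 = 1"
  obtains M where "real_distribution M" "AE x in M. x \<in> {0..1}" "\<And>k. (\<integral>x. x ^ k \<partial>M) = c k 0"
proof -
  define w where "w n k = (if k \<le> n then (n choose k) * c k (n - k) else 0)" for n k
  have expand: "c a b = (\<Sum>k\<le>n. (n choose k) * c (a + k) (b + n - k))" for a b n
  proof (induction n arbitrary: a b)
    case (Suc n)
    have "(\<Sum>k\<le>Suc n. (Suc n choose k) * c (a + k) (b + Suc n - k))
        = (\<Sum>k\<le>n. (n choose k) * c (a + k) (Suc b + n - k))
          + (\<Sum>k\<le>n. (n choose k) * c (Suc a + k) (b + n - k))"
      by (subst sum_binomial_Suc) simp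
    then show ?case using Suc.IH[of a "Suc b"] Suc.IH[of "Suc a" b] pascal[of a b] by simp
  qed simp
  have w_nonneg: "0 \<le> w n k" for n k using nonneg by (simp add: w_def)
  have w_sum: "(\<Sum>k\<le>n. w n k) = 1" for n
  proof -
    have "(\<Sum>k\<le>n. w n k) = (\<Sum>k\<le>n. (n choose k) * c (0 + k) (0 + n - k))"
      by (intro sum.cong) (auto simp: w_def)
    then show ?thesis using expand[of 0 0 n] total by simp
  qed
  have falling: "(\<Sum>k\<le>n. w n k * (\<Prod>i<m. (real k - real i) / (real n - real i))) = c m 0"
    if "m < n" for m n
  proof -
    define l where "l = n - m"
    have n: "n = l + m" using that by (simp add: l_def)
    have nz: "(\<Prod>i<m. real n - real i) \<noteq> 0" using that by auto
    have "(\<Sum>k\<le>n. w n k * (\<Prod>i<m. (real k - real i) / (real n - real i)))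
        = (\<Sum>k\<le>n. (n choose k) * (\<Prod>i<m. real k - real i) * c k (n - k)) / (\<Prod>i<m. real n - real i)"
      unfolding sum_divide_distrib
      by (intro sum.cong) (simp_all add: w_def prod_dividef)
    also have "\<dots> = (\<Sum>k\<le>l. (l choose k) * c (k + m) (n - (k + m)))"
      using nz unfolding n by (subst sum_binomial_falling) simp
    also have "\<dots> = c m 0"
      unfolding expand[of m 0 l] by (intro sum.cong) (auto simp: n add.commute)
    finally show ?thesis .
  qed
  define B where "B n m = (\<Sum>k\<le>Suc n. w (Suc n) k * (k / Suc n) ^ m)" for n m
  have power_limit: "(\<lambda>n. B n m) \<longlonglongrightarrow> c m 0" for m
  proof (rule Lim_null_comparison[THEN LIM_zero_cancel])
    show "\<forall>\<^sub>F n in sequentially. norm (B n m - c m 0) \<le> m * (m / (real (Suc n) - m))"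
    proof (rule eventually_sequentiallyI)
      fix n assume n: "2 * m \<le> n"
      let ?N = "Suc n"
      have "B n m - c m 0 = (\<Sum>k\<le>?N. w ?N k
          * ((k / ?N) ^ m - (\<Prod>i<m. (real k - real i) / (real ?N - real i))))"
        using falling[of m ?N] n by (simp add: B_def sum_subtractf right_diff_distrib del: sum.atMost_Suc)
      also have "norm \<dots> \<le> (\<Sum>k\<le>?N. w ?N k * (m * (m / (real ?N - m))))"
      proof (rule sum_norm_le)
        fix k assume "k \<in> {..?N}"
        then show "norm (w ?N k * ((k / ?N) ^ m - (\<Prod>i<m. (real k - real i) / (real ?N - real i))))
          \<le> w ?N k * (m * (m / (real ?N - m)))"
          unfolding real_norm_def abs_mult abs_of_nonneg[OF w_nonneg]
          using n by (intro mult_left_mono abs_power_ratio_falling_le w_nonneg) auto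
      qed
      also have "\<dots> = m * (m / (real ?N - m))"
        by (simp only: sum_distrib_right[symmetric] w_sum mult_1_left)
      finally show "norm (B n m - c m 0) \<le> m * (m / (real ?N - m))" .
    qed
    show "(\<lambda>n. m * (m / (real (Suc n) - m))) \<longlonglongrightarrow> 0"
      by real_asymp
  qed
  define p where "p n = embed_pmf (w (Suc n))" for n
  have pmf_p: "pmf (p n) k = w (Suc n) k" for n k
    unfolding p_def
  proof (rule pmf_embed_pmf)
    have "(\<integral>\<^sup>+k. ennreal (w (Suc n) k) \<partial>count_space UNIV) = (\<Sum>k\<le>Suc n. ennreal (w (Suc n) k))"
      by (rule nn_integral_count_space') (auto simp: w_def)
    also have "\<dots> = 1"
      using w_nonneg w_sum by (simp only: sum_ennreal ennreal_1)
    finally show "(\<integral>\<^sup>+k. ennreal (w (Suc n) k) \<partial>count_space UNIV) = 1" .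
  qed (rule w_nonneg)
  have p_supp: "k \<le> Suc n" if "k \<in> set_pmf (p n)" for n k
    using that by (auto simp: set_pmf_iff pmf_p w_def split: if_splits)
  \<comment> \<open>The denominator is \<open>Suc n\<close>, so that it never vanishes.\<close>
  define \<nu> where "\<nu> n = distr (measure_pmf (p n)) borel (\<lambda>k. real k / real (Suc n))" for n
  have \<nu>: "real_distribution (\<nu> n)" for n
    unfolding \<nu>_def by (rule prob_space.real_distribution_distr) (auto intro: measure_pmf.prob_space_axioms)
  have \<nu>_supp: "AE x in \<nu> n. x \<in> {0..1}" for n
    unfolding \<nu>_def by (subst AE_distr_iff) (auto simp: AE_measure_pmf_iff dest: p_supp)
  have "tight \<nu>"
    unfolding tight_def
  proof (intro conjI allI impI)
    fix \<epsilon> :: real assume \<epsilon>: "0 < \<epsilon>"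
    have "measure (\<nu> n) {- 1<..1} = 1" for n
    proof -
      interpret real_distribution "\<nu> n" by (rule \<nu>)
      show ?thesis by (subst prob_eq_1) (use \<nu>_supp[of n] in \<open>auto elim: eventually_mono\<close>)
    qed
    then show "\<exists>a b. a < b \<and> (\<forall>n. 1 - \<epsilon> < measure (\<nu> n) {a<..b})"
      using \<epsilon> by (intro exI[of _ "-1"] exI[of _ 1]) simp
  qed (rule \<nu>)
  then obtain r M where r: "strict_mono r" and M: "real_distribution M"
    and conv: "weak_conv_m (\<nu> \<circ> id \<circ> r) M"
    using tight_imp_convergent_subsubsequence[OF _ strict_mono_id] by blast
  interpret M: real_distribution M by fact
  \<comment> \<open>Weak convergence only tests bounded functions. Truncating to the unit interval makes the powers
    bounded without changing the integrals over the approximating measures, and pushing the limit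
    forward along the truncation makes its support evident.\<close>
  define clamp :: "real \<Rightarrow> real" where "clamp x = max 0 (min 1 x)" for x
  have clamp_meas [measurable]: "clamp \<in> borel_measurable borel"
    unfolding clamp_def[abs_def] by measurable
  have clamp: "0 \<le> clamp x" "clamp x \<le> 1" for x by (auto simp: clamp_def)
  have clamp_moment: "(\<integral>x. clamp x ^ m \<partial>M) = c m 0" for m
  proof (rule LIMSEQ_unique)
    show "(\<lambda>n. \<integral>x. clamp x ^ m \<partial>(\<nu> \<circ> id \<circ> r) n) \<longlonglongrightarrow> (\<integral>x. clamp x ^ m \<partial>M)"
    proof (rule weak_conv_imp_integral_bdd_continuous_conv[OF _ M conv])
      show "isCont (\<lambda>x. clamp x ^ m) x" for x
        unfolding clamp_def by (intro continuous_intros)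
      show "norm (clamp x ^ m) \<le> 1" for x
        using clamp[of x] by (simp add: power_le_one)
    qed (use \<nu> in simp)
    have "(\<integral>x. clamp x ^ m \<partial>\<nu> n) = B n m" for n
    proof -
      have "(\<integral>x. clamp x ^ m \<partial>\<nu> n) = (\<integral>k. clamp (real k / real (Suc n)) ^ m \<partial>measure_pmf (p n))"
        unfolding \<nu>_def by (rule integral_distr) auto
      also have "\<dots> = (\<Sum>k\<le>Suc n. clamp (real k / real (Suc n)) ^ m * pmf (p n) k)"
        by (rule integral_measure_pmf_real) (auto dest: p_supp)
      also have "\<dots> = B n m"
        unfolding B_def by (intro sum.cong) (auto simp: pmf_p clamp_def mult.commute)
      finally show ?thesis .
    qed
    then show "(\<lambda>n. \<integral>x. clamp x ^ m \<partial>(\<nu> \<circ> id \<circ> r) n) \<longlonglongrightarrow> c m 0"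
      using LIMSEQ_subseq_LIMSEQ[OF power_limit r] by (simp add: o_def)
  qed
  show thesis
  proof (rule that)
    show "real_distribution (distr M borel clamp)"
      by (rule M.real_distribution_distr) simp
    show "AE x in distr M borel clamp. x \<in> {0..1}"
      by (subst AE_distr_iff) (use clamp in auto)
    show "(\<integral>x. x ^ k \<partial>distr M borel clamp) = c k 0" for k
      by (subst integral_distr) (simp_all add: clamp_moment)
  qed
qed

section \<open>Cauchy transforms\<close>

context real_distribution
begin

text \<open>Markov's inequality for the power \<open>2 n\<close> bounds the mass outside \<open>(-R, R)\<close> by
  \<open>(D / R) ^ (2 * n)\<close>, which tends to zero if \<open>R\<close> exceeds \<open>D\<close>.\<close>

lemma AE_abs_le_of_moments:
  fixes D :: real
  assumes D: "0 \<le> D" and int: "\<And>n. integrable M (\<lambda>x. x ^ n)"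
    and bound: "\<And>n. (\<integral>x. x ^ n \<partial>M) \<le> D ^ n"
  shows "AE x in M. \<bar>x\<bar> \<le> D"
proof -
  have R: "AE x in M. \<bar>x\<bar> < R" if R: "D < R" for R
  proof -
    have R0: "0 < R" using D R by simp
    have le: "prob {x \<in> space M. R \<le> \<bar>x\<bar>} \<le> ((D / R)\<^sup>2) ^ n" for n
    proof -
      have "{x \<in> space M. R \<le> \<bar>x\<bar>} \<subseteq> {x \<in> space M. R ^ (2 * n) \<le> x ^ (2 * n)}"
      proof safe
        fix x assume "R \<le> \<bar>x\<bar>"
        then have "R ^ (2 * n) \<le> \<bar>x\<bar> ^ (2 * n)" using R0 by (intro power_mono) auto
        then show "R ^ (2 * n) \<le> x ^ (2 * n)" by (simp add: power_even_abs)
      qed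
      then have "prob {x \<in> space M. R \<le> \<bar>x\<bar>} \<le> prob {x \<in> space M. R ^ (2 * n) \<le> x ^ (2 * n)}"
        by (intro finite_measure_mono) auto
      also have "\<dots> \<le> (\<integral>x. x ^ (2 * n) \<partial>M) / R ^ (2 * n)"
        by (rule integral_Markov_inequality_measure[where A = "space M"]) (use int R0 in auto)
      also have "\<dots> \<le> D ^ (2 * n) / R ^ (2 * n)"
        using bound R0 by (intro divide_right_mono) auto
      finally show ?thesis by (simp add: power_divide power_mult)
    qed
    have "(\<lambda>n. ((D / R)\<^sup>2) ^ n) \<longlonglongrightarrow> 0"
      using D R R0 by (intro LIMSEQ_power_zero) (simp add: power_less_one_iff abs_square_less_1)
    then have "prob {x \<in> space M. R \<le> \<bar>x\<bar>} \<le> 0"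
      by (rule LIMSEQ_le_const) (use le in blast)
    then have "prob {x \<in> space M. R \<le> \<bar>x\<bar>} = 0" using measure_nonneg by (rule antisym)
    then have "AE x in M. \<not> R \<le> \<bar>x\<bar>"
      by (subst AE_iff_measurable[OF _ refl]) (simp_all add: emeasure_eq_measure)
    then show ?thesis by (simp add: not_le)
  qed
  have "AE x in M. \<forall>n. \<bar>x\<bar> < D + inverse (Suc n)"
    by (subst AE_all_countable) (auto intro!: R)
  then show ?thesis
  proof eventually_elim
    case (elim x)
    show "\<bar>x\<bar> \<le> D"
    proof (rule field_le_epsilon)
      fix \<epsilon> :: real assume "0 < \<epsilon>"
      then obtain n where "inverse (Suc n) < \<epsilon>" using reals_Archimedean by blast
      then show "\<bar>x\<bar> \<le> D + \<epsilon>" using elim[rule_format, of n] by linarith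
    qed
  qed
qed

lemma sums_cauchy_transform:
  fixes D :: real
  assumes D: "0 \<le> D" and supp: "AE x in M. \<bar>x\<bar> \<le> D" and z: "D < norm z"
  shows "(\<lambda>n. complex_of_real (\<integral>x. x ^ n \<partial>M) / z ^ (n + 1)) sums cauchy_transform M z"
proof -
  have z0: "z \<noteq> 0" "0 < norm z" using z D by auto
  have int: "integrable M (\<lambda>x. x ^ n)" for n
  proof (rule integrable_const_bound)
    show "AE x in M. norm (x ^ n) \<le> D ^ n"
      using supp by eventually_elim (simp add: power_abs power_mono)
  qed simp
  let ?f = "\<lambda>n x. complex_of_real (x ^ n) / z ^ (n + 1)"
  have int_f: "integrable M (?f n)" for n
    using int[of n] by (intro integrable_divide integrable_of_real) auto
  have norm_f: "norm (?f n x) \<le> 1 / norm z * (D / norm z) ^ n" if "\<bar>x\<bar> \<le> D" for n x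
    using power_mono[OF that abs_ge_zero, of n] z0
    by (simp add: norm_divide norm_mult norm_power power_divide power_abs divide_right_mono mult.commute)
  have summ: "summable (\<lambda>n. 1 / norm z * (D / norm z) ^ n)"
    using z D z0 by (intro summable_mult summable_geometric) simp
  have "(\<lambda>n. integral\<^sup>L M (?f n)) sums (\<integral>x. (\<Sum>n. ?f n x) \<partial>M)"
  proof (rule sums_integral[OF int_f])
    show "AE x in M. summable (\<lambda>n. norm (?f n x))"
      using supp
      by eventually_elim (rule summable_comparison_test'[OF summ, of 0], simp only: real_norm_def abs_norm_cancel norm_f)
    have "norm (\<integral>x. norm (?f n x) \<partial>M) \<le> 1 / norm z * (D / norm z) ^ n" for n
    proof -
      have "(\<integral>x. norm (?f n x) \<partial>M) \<le> (\<integral>x. 1 / norm z * (D / norm z) ^ n \<partial>M)"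
      proof (rule integral_mono_AE)
        show "AE x in M. norm (?f n x) \<le> 1 / norm z * (D / norm z) ^ n"
          using supp by eventually_elim (rule norm_f)
      qed (use int_f in auto)
      then show ?thesis by (simp add: prob_space[unfolded space_eq_univ])
    qed
    then show "summable (\<lambda>n. \<integral>x. norm (?f n x) \<partial>M)"
      by (rule summable_comparison_test'[OF summ, of 0])
  qed
  moreover have "(\<integral>x. (\<Sum>n. ?f n x) \<partial>M) = cauchy_transform M z"
    unfolding cauchy_transform_def
  proof (rule integral_cong_AE)
    show "AE x in M. (\<Sum>n. ?f n x) = 1 / (z - complex_of_real x)"
      using supp
    proof eventually_elim
      case (elim x)
      have xz: "norm (complex_of_real x / z) < 1" using elim z z0 by (simp add: norm_divide)
      then have "(\<lambda>n. 1 / z * (complex_of_real x / z) ^ n) sums (1 / z * (1 / (1 - complex_of_real x / z)))"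
        by (intro sums_mult geometric_sums)
      moreover have "1 / z * (1 / (1 - complex_of_real x / z)) = 1 / (z - complex_of_real x)"
        using z0 by (simp add: field_simps)
      moreover have "(\<lambda>n. 1 / z * (complex_of_real x / z) ^ n) = (\<lambda>n. ?f n x)"
        by (simp add: power_divide)
      ultimately show ?case using sums_unique by metis
    qed
  qed simp_all
  moreover have "(\<lambda>n. integral\<^sup>L M (?f n)) = (\<lambda>n. complex_of_real (\<integral>x. x ^ n \<partial>M) / z ^ (n + 1))"
    by (rule ext) (simp del: of_real_power)
  ultimately show ?thesis by (simp only:)
qed

lemma norm_cauchy_kernel_le:
  assumes "0 < Im z"
  shows "norm (1 / (z - complex_of_real x)) \<le> 1 / Im z"
proof -
  have "Im z \<le> norm (z - complex_of_real x)"
    using abs_Im_le_cmod[of "z - complex_of_real x"] by simp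
  then show ?thesis using assms by (simp add: norm_divide frac_le)
qed

lemma integrable_cauchy_kernel:
  assumes "0 < Im z"
  shows "integrable M (\<lambda>x. 1 / (z - complex_of_real x))"
  by (rule integrable_const_bound[where B = "1 / Im z"])
    (use norm_cauchy_kernel_le[OF assms] in auto)

text \<open>The imaginary part is, up to a constant, the density of the convolution with a Cauchy
  distribution. This is what makes inversion possible, and it shows that a reciprocal Cauchy
  transform maps the upper half-plane into itself.\<close>

lemma Im_cauchy_transform:
  assumes "0 < Im z"
  shows "Im (cauchy_transform M z) = - (\<integral>x. Im z / ((Re z - x)\<^sup>2 + (Im z)\<^sup>2) \<partial>M)"
proof -
  have "Im (cauchy_transform M z) = (\<integral>x. Im (1 / (z - complex_of_real x)) \<partial>M)"
    unfolding cauchy_transform_def by (rule integral_Im[symmetric, OF integrable_cauchy_kernel[OF assms]])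
  also have "\<dots> = (\<integral>x. - (Im z / ((Re z - x)\<^sup>2 + (Im z)\<^sup>2)) \<partial>M)"
    by (simp add: Im_divide)
  finally show ?thesis by simp
qed

lemma integrable_poisson_kernel:
  fixes y :: real
  assumes "0 < y"
  shows "integrable M (\<lambda>t. y / ((x - t)\<^sup>2 + y\<^sup>2))"
proof (rule integrable_const_bound[where B = "1 / y"])
  have "y / ((x - t)\<^sup>2 + y\<^sup>2) \<le> y / y\<^sup>2" for t
    using assms by (intro frac_le) auto
  then show "AE t in M. norm (y / ((x - t)\<^sup>2 + y\<^sup>2)) \<le> 1 / y"
    using assms by (simp add: power2_eq_square)
qed simp

lemma Im_cauchy_transform_neg:
  assumes "0 < Im z"
  shows "Im (cauchy_transform M z) < 0"
proof -
  let ?p = "\<lambda>t. Im z / ((Re z - t)\<^sup>2 + (Im z)\<^sup>2)"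
  have pos: "0 < ?p t" for t
    using assms by (intro divide_pos_pos add_nonneg_pos) auto
  have "integral\<^sup>L M ?p \<noteq> 0"
  proof
    assume "integral\<^sup>L M ?p = 0"
    then have "AE t in M. ?p t = 0"
      using integral_nonneg_eq_0_iff_AE[OF integrable_poisson_kernel[OF assms]] pos less_imp_le by blast
    then have "AE t in M. False"
      by eventually_elim (use pos in \<open>metis less_irrefl\<close>)
    then show False by simp
  qed
  moreover have "0 \<le> integral\<^sup>L M ?p"
    using pos by (intro integral_nonneg_AE) (auto intro: less_imp_le)
  ultimately show ?thesis using Im_cauchy_transform[OF assms] by simp
qed

lemma cauchy_transform_nonzero: "0 < Im z \<Longrightarrow> cauchy_transform M z \<noteq> 0"
  using Im_cauchy_transform_neg[of z] by auto

lemma Im_recip_cauchy_pos: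
  assumes "0 < Im z"
  shows "0 < Im (recip_cauchy M z)"
proof -
  let ?G = "cauchy_transform M z"
  have "Im (recip_cauchy M z) = - Im ?G / ((Re ?G)\<^sup>2 + (Im ?G)\<^sup>2)"
    by (simp add: recip_cauchy_def Im_divide)
  also have "\<dots> > 0"
    using Im_cauchy_transform_neg[OF assms] by (intro divide_pos_pos add_nonneg_pos) auto
  finally show ?thesis .
qed

lemma cauchy_kernel_quotient:
  fixes a b c :: complex
  assumes "z - c \<noteq> 0" "w - c \<noteq> 0" "z \<noteq> w"
  shows "(1 / (z - c) - 1 / (w - c)) / (z - w) + 1 / (w - c) * (1 / (w - c))
    = (z - w) * (1 / (w - c) * (1 / (w - c) * (1 / (z - c))))"
proof -
  have "1 / (z - c) - 1 / (w - c) = - ((z - w) * (1 / (z - c) * (1 / (w - c))))"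
    using assms by (simp add: divide_simps)
  then have "(1 / (z - c) - 1 / (w - c)) / (z - w) = - (1 / (z - c) * (1 / (w - c)))"
    using assms by simp
  moreover have "1 / (w - c) - 1 / (z - c) = (z - w) * (1 / (z - c) * (1 / (w - c)))"
    using assms by (simp add: divide_simps)
  then have "1 / (w - c) * (1 / (w - c) - 1 / (z - c))
    = 1 / (w - c) * ((z - w) * (1 / (z - c) * (1 / (w - c))))" by simp
  ultimately show ?thesis by (simp add: algebra_simps)
qed

text \<open>The difference quotient at \<open>w\<close> and minus the integral of the squared kernel differ by \<open>z - w\<close> times the integral of
  a product of three kernels, and these are uniformly bounded away from the real axis.\<close>

lemma holomorphic_cauchy_transform: "cauchy_transform M holomorphic_on {z. 0 < Im z}"
proof (rule holomorphic_onI)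
  fix w assume "w \<in> {z. 0 < Im z}"
  then have w: "0 < Im w" by simp
  define \<eta> where "\<eta> = Im w / 2"
  have \<eta>: "0 < \<eta>" "\<eta> < Im w" using w by (simp_all add: \<eta>_def)
  let ?k = "\<lambda>z x. 1 / (z - complex_of_real x)"
  define d where "d = - (\<integral>x. ?k w x * ?k w x \<partial>M)"
  have k_le: "norm (?k z x) \<le> 1 / \<eta>" if "\<eta> < Im z" for z x
  proof -
    have "1 / Im z \<le> 1 / \<eta>" using that \<eta> by (intro frac_le) auto
    then show ?thesis using norm_cauchy_kernel_le[of z x] that \<eta> by linarith
  qed
  have int2: "integrable M (\<lambda>x. ?k w x * ?k w x)"
  proof (rule integrable_const_bound)
    show "AE x in M. norm (?k w x * ?k w x) \<le> 1 / \<eta> * (1 / \<eta>)"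
      unfolding norm_mult using \<eta> by (intro AE_I2 mult_mono k_le norm_ge_zero) auto
  qed simp
  have "((\<lambda>z. (cauchy_transform M z - cauchy_transform M w) / (z - w) - d) \<longlongrightarrow> 0) (at w)"
  proof (rule Lim_null_comparison)
    have "((\<lambda>z. norm (z - w) * (1 / \<eta> * (1 / \<eta> * (1 / \<eta>)))) \<longlongrightarrow> norm (w - w) * (1 / \<eta> * (1 / \<eta> * (1 / \<eta>)))) (at w)"
      by (intro tendsto_intros)
    then show "((\<lambda>z. norm (z - w) * (1 / \<eta> * (1 / \<eta> * (1 / \<eta>)))) \<longlongrightarrow> 0) (at w)" by simp
    have "open {z. \<eta> < Im z}" by (rule open_halfspace_Im_gt)
    then have "\<forall>\<^sub>F z in at w. z \<in> {z. \<eta> < Im z} \<and> z \<noteq> w"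
      using \<eta> by (auto simp: eventually_at_filter intro: eventually_mono[OF eventually_nhds_in_open])
    then show "\<forall>\<^sub>F z in at w. norm ((cauchy_transform M z - cauchy_transform M w) / (z - w) - d)
        \<le> norm (z - w) * (1 / \<eta> * (1 / \<eta> * (1 / \<eta>)))"
    proof eventually_elim
      case (elim z)
      then have z: "\<eta> < Im z" "z \<noteq> w" by auto
      have nz: "z - complex_of_real x \<noteq> 0" "w - complex_of_real x \<noteq> 0" for x
        using z \<eta> by (auto simp: complex_eq_iff)
      have ints: "integrable M (?k z)" "integrable M (?k w)"
        using z \<eta> by (auto intro!: integrable_cauchy_kernel)
      have "(cauchy_transform M z - cauchy_transform M w) / (z - w) - d
          = (\<integral>x. (?k z x - ?k w x) / (z - w) + ?k w x * ?k w x \<partial>M)"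
        using ints int2 by (simp add: d_def cauchy_transform_def)
      also have "\<dots> = (\<integral>x. (z - w) * (?k w x * (?k w x * ?k z x)) \<partial>M)"
        using nz z(2) by (intro Bochner_Integration.integral_cong refl cauchy_kernel_quotient) auto
      finally have eq: "(cauchy_transform M z - cauchy_transform M w) / (z - w) - d
          = (\<integral>x. (z - w) * (?k w x * (?k w x * ?k z x)) \<partial>M)" .
      have le: "norm ((z - w) * (?k w x * (?k w x * ?k z x)))
          \<le> norm (z - w) * (1 / \<eta> * (1 / \<eta> * (1 / \<eta>)))" for x
        unfolding norm_mult using \<eta> z
        by (intro mult_left_mono mult_mono k_le mult_nonneg_nonneg norm_ge_zero) auto
      show ?case
        unfolding eq
      proof (rule order_trans[OF integral_norm_bound])
        have "integrable M (\<lambda>x. (z - w) * (?k w x * (?k w x * ?k z x)))"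
          by (rule integrable_const_bound) (use le in auto)
        then have "(\<integral>x. norm ((z - w) * (?k w x * (?k w x * ?k z x))) \<partial>M)
            \<le> (\<integral>x. norm (z - w) * (1 / \<eta> * (1 / \<eta> * (1 / \<eta>))) \<partial>M)"
          using le by (intro integral_mono integrable_norm) simp_all
        then show "(\<integral>x. norm ((z - w) * (?k w x * (?k w x * ?k z x))) \<partial>M)
            \<le> norm (z - w) * (1 / \<eta> * (1 / \<eta> * (1 / \<eta>)))"
          by (simp add: prob_space[unfolded space_eq_univ])
      qed
    qed
  qed
  then have "(cauchy_transform M has_field_derivative d) (at w)"
    unfolding has_field_derivative_iff by (simp add: LIM_zero_iff)
  then show "cauchy_transform M field_differentiable at w within {z. 0 < Im z}"
    using field_differentiable_def field_differentiable_at_within by blast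
qed

lemma holomorphic_recip_cauchy: "recip_cauchy M holomorphic_on {z. 0 < Im z}"
  unfolding recip_cauchy_def[abs_def]
  using holomorphic_cauchy_transform cauchy_transform_nonzero by (intro holomorphic_intros) auto

text \<open>The integral of \<open>sgn (b - t)\<close> is a version of the distribution function that counts an atom at
  \<open>b\<close> with half its weight. This form arises because \<open>arctan\<close> of a growing multiple of its argument
  tends to \<open>pi / 2 * sgn\<close>, also at zero, so that no continuity points have to be chosen.\<close>

lemma sign_integral_diff_eq:
  assumes "a \<le> b"
  shows "(\<lambda>n. \<integral>t. arctan ((b - t) * Suc n) - arctan ((a - t) * Suc n) \<partial>M)
    \<longlonglongrightarrow> pi / 2 * ((\<integral>t. sgn (b - t) \<partial>M) - (\<integral>t. sgn (a - t) \<partial>M))"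
proof -
  have int_sgn: "integrable M (\<lambda>t. sgn (c - t))" for c :: real
    by (rule integrable_const_bound[where B = 1]) (auto simp: sgn_real_def)
  have lim: "(\<lambda>n. arctan ((c - t) * Suc n)) \<longlonglongrightarrow> pi / 2 * sgn (c - t)" for c t :: real
  proof -
    have top: "filterlim (\<lambda>n. real (Suc n)) at_top sequentially"
      using filterlim_real_sequentially by (rule filterlim_compose[OF _ filterlim_Suc])
    consider "c - t = 0" | "c - t > 0" | "c - t < 0" by linarith
    then show ?thesis
    proof cases
      case 2
      have "filterlim (\<lambda>n. (c - t) * Suc n) at_top sequentially"
        by (rule filterlim_tendsto_pos_mult_at_top[OF tendsto_const 2 top])
      then show ?thesis
        using filterlim_compose[OF tendsto_arctan_at_top] 2 by simp
    next
      case 3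
      have "filterlim (\<lambda>n. (c - t) * Suc n) at_bot sequentially"
        by (rule filterlim_tendsto_neg_mult_at_bot[OF tendsto_const 3 top])
      then show ?thesis
        using filterlim_compose[OF tendsto_arctan_at_bot] 3 by simp
    qed simp
  qed
  have "(\<lambda>n. \<integral>t. arctan ((b - t) * Suc n) - arctan ((a - t) * Suc n) \<partial>M)
    \<longlonglongrightarrow> (\<integral>t. pi / 2 * sgn (b - t) - pi / 2 * sgn (a - t) \<partial>M)"
  proof (rule integral_dominated_convergence[where w = "\<lambda>_. pi"])
    show "AE t in M. (\<lambda>n. arctan ((b - t) * Suc n) - arctan ((a - t) * Suc n))
      \<longlonglongrightarrow> pi / 2 * sgn (b - t) - pi / 2 * sgn (a - t)"
      by (intro AE_I2 tendsto_diff lim)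
    show "AE t in M. norm (arctan ((b - t) * Suc n) - arctan ((a - t) * Suc n)) \<le> pi" for n
    proof (rule AE_I2)
      fix t
      show "norm (arctan ((b - t) * Suc n) - arctan ((a - t) * Suc n)) \<le> pi"
        using arctan_bounded[of "(b - t) * Suc n"] arctan_bounded[of "(a - t) * Suc n"]
        unfolding real_norm_def by linarith
    qed
  qed simp_all
  also have "(\<integral>t. pi / 2 * sgn (b - t) - pi / 2 * sgn (a - t) \<partial>M)
    = pi / 2 * ((\<integral>t. sgn (b - t) \<partial>M) - (\<integral>t. sgn (a - t) \<partial>M))"
    using int_sgn by (simp add: right_diff_distrib)
  finally show ?thesis .
qed

text \<open>Stieltjes inversion before the limit: integrate the Poisson kernel over an interval, with the two
  integrals exchanged by Tonelli's theorem.\<close>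

lemma integral_arctan_eq:
  fixes y :: real
  assumes "a \<le> b" "0 < y"
  shows "ennreal (\<integral>t. arctan ((b - t) / y) - arctan ((a - t) / y) \<partial>M)
    = (\<integral>\<^sup>+x. ennreal (- Im (cauchy_transform M (Complex x y))) * indicator {a..b} x \<partial>lborel)"
proof -
  interpret pair: pair_sigma_finite lborel M
    by (intro pair_sigma_finite.intro sigma_finite_lborel) (rule sigma_finite_measure_axioms)
  let ?p = "\<lambda>x t. y / ((x - t)\<^sup>2 + y\<^sup>2)"
  have p_nonneg: "0 \<le> ?p x t" for x t using assms by simp
  have "(\<integral>\<^sup>+x. ennreal (- Im (cauchy_transform M (Complex x y))) * indicator {a..b} x \<partial>lborel)
      = (\<integral>\<^sup>+x. (\<integral>\<^sup>+t. ennreal (?p x t) * indicator {a..b} x \<partial>M) \<partial>lborel)"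
  proof (rule nn_integral_cong)
    fix x
    have "ennreal (- Im (cauchy_transform M (Complex x y))) = (\<integral>\<^sup>+t. ennreal (?p x t) \<partial>M)"
      using assms Im_cauchy_transform[of "Complex x y"] p_nonneg
      by (subst nn_integral_eq_integral[OF integrable_poisson_kernel]) auto
    then show "ennreal (- Im (cauchy_transform M (Complex x y))) * indicator {a..b} x
      = (\<integral>\<^sup>+t. ennreal (?p x t) * indicator {a..b} x \<partial>M)"
      by (simp add: nn_integral_multc)
  qed
  also have "\<dots> = (\<integral>\<^sup>+t. (\<integral>\<^sup>+x. ennreal (?p x t) * indicator {a..b} x \<partial>lborel) \<partial>M)"
    by (rule pair.Fubini'[symmetric]) simp
  also have "\<dots> = (\<integral>\<^sup>+t. ennreal (arctan ((b - t) / y) - arctan ((a - t) / y)) \<partial>M)"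
  proof (rule nn_integral_cong)
    fix t
    show "(\<integral>\<^sup>+x. ennreal (?p x t) * indicator {a..b} x \<partial>lborel)
      = ennreal (arctan ((b - t) / y) - arctan ((a - t) / y))"
    proof (rule nn_integral_FTC_Icc)
      fix x
      have "((\<lambda>x. arctan ((x - t) / y)) has_real_derivative
        inverse (1 + ((x - t) / y)\<^sup>2) * (1 / y)) (at x)"
        using assms(2) by (auto intro!: derivative_eq_intros simp: field_simps)
      moreover have "inverse (1 + ((x - t) / y)\<^sup>2) * (1 / y) = ?p x t"
        using assms(2) by (simp add: divide_simps power2_eq_square)
      ultimately show "((\<lambda>x. arctan ((x - t) / y)) has_real_derivative ?p x t) (at x)"
        by (simp only:)
    qed (use assms p_nonneg in simp_all)
  qed
  also have "\<dots> = ennreal (\<integral>t. arctan ((b - t) / y) - arctan ((a - t) / y) \<partial>M)"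
  proof (rule nn_integral_eq_integral)
    show "integrable M (\<lambda>t. arctan ((b - t) / y) - arctan ((a - t) / y))"
    proof (rule integrable_const_bound[where B = pi])
      have "norm (arctan ((b - t) / y) - arctan ((a - t) / y)) \<le> pi" for t
        using arctan_bounded[of "(b - t) / y"] arctan_bounded[of "(a - t) / y"]
        unfolding real_norm_def by linarith
      then show "AE t in M. norm (arctan ((b - t) / y) - arctan ((a - t) / y)) \<le> pi" by simp
    qed simp
    show "AE t in M. 0 \<le> arctan ((b - t) / y) - arctan ((a - t) / y)"
      using assms by (auto simp: arctan_le_iff divide_right_mono)
  qed
  finally show ?thesis ..
qed

lemma sign_integral_at_bot: "(\<lambda>n. \<integral>t. sgn (- real n - t) \<partial>M) \<longlonglongrightarrow> -1"
proof -
  have "(\<lambda>n. \<integral>t. sgn (- real n - t) \<partial>M) \<longlonglongrightarrow> (\<integral>t. -1 \<partial>M)"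
  proof (rule integral_dominated_convergence[where w = "\<lambda>_. 1"])
    show "AE t in M. (\<lambda>n. sgn (- real n - t)) \<longlonglongrightarrow> -1"
    proof (rule AE_I2, rule tendsto_eventually)
      fix t :: real
      obtain N :: nat where "- t < N" using reals_Archimedean2 by blast
      then show "\<forall>\<^sub>F n in sequentially. sgn (- real n - t) = -1"
        by (intro eventually_sequentiallyI[of N]) (simp add: sgn_real_def)
    qed
  qed (auto simp: sgn_real_def)
  then show ?thesis by (simp add: prob_space[unfolded space_eq_univ])
qed

lemma sign_integral_at_right:
  "(\<lambda>n. \<integral>t. sgn (x + inverse (Suc n) - t) \<partial>M) \<longlonglongrightarrow> 2 * cdf M x - 1"
proof -
  have "(\<lambda>n. \<integral>t. sgn (x + inverse (Suc n) - t) \<partial>M) \<longlonglongrightarrow> (\<integral>t. 2 * indicator {..x} t - 1 \<partial>M)"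
  proof (rule integral_dominated_convergence[where w = "\<lambda>_. 1"])
    show "AE t in M. (\<lambda>n. sgn (x + inverse (Suc n) - t)) \<longlonglongrightarrow> 2 * indicator {..x} t - 1"
    proof (rule AE_I2, rule tendsto_eventually)
      fix t :: real
      show "\<forall>\<^sub>F n in sequentially. sgn (x + inverse (Suc n) - t) = 2 * indicator {..x} t - 1"
      proof (cases "t \<le> x")
        case True
        then have "x + inverse (Suc n) - t > 0" for n
          using inverse_positive_iff_positive[of "real (Suc n)"] by linarith
        then show ?thesis using True by simp
      next
        case False
        then obtain N where N: "inverse (real (Suc N)) < t - x"
          using reals_Archimedean[of "t - x"] by auto
        have "x + inverse (Suc n) - t < 0" if "N \<le> n" for n
        proof -
          have "inverse (real (Suc n)) \<le> inverse (real (Suc N))" using that by simp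
          then show ?thesis using N by linarith
        qed
        then show ?thesis
          using False by (intro eventually_sequentiallyI[of N]) simp
      qed
    qed
  qed (auto simp: sgn_real_def)
  moreover have "integrable M (\<lambda>t. indicator {..x} t :: real)"
    by (rule integrable_const_bound[where B = 1]) auto
  ultimately show ?thesis by (simp add: cdf_def prob_space[unfolded space_eq_univ])
qed

end

text \<open>The Cauchy transform determines the integrals of \<open>arctan\<close> differences, and in the limit the
  differences of the sign integrals. Letting the left end point tend to \<open>-\<infinity>\<close> gives the sign
  integrals themselves, and approaching a point from the right gives the distribution function.\<close>

theorem cauchy_transform_unique:
  assumes "real_distribution M" "real_distribution N"
    and eq: "\<And>z. 0 < Im z \<Longrightarrow> cauchy_transform M z = cauchy_transform N z"
  shows "M = N"
proof -
  interpret M: real_distribution M by fact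
  interpret N: real_distribution N by fact
  have arctan_eq: "(\<integral>t. arctan ((b - t) * Suc n) - arctan ((a - t) * Suc n) \<partial>M)
      = (\<integral>t. arctan ((b - t) * Suc n) - arctan ((a - t) * Suc n) \<partial>N)" if "a \<le> b" for a b n
  proof -
    have y: "0 < 1 / real (Suc n)" by simp
    have nonneg: "0 \<le> (\<integral>t. arctan ((b - t) * Suc n) - arctan ((a - t) * Suc n) \<partial>L)" for L
      using that by (intro Bochner_Integration.integral_nonneg) (simp add: arctan_le_iff mult_right_mono)
    have "ennreal (\<integral>t. arctan ((b - t) / (1 / Suc n)) - arctan ((a - t) / (1 / Suc n)) \<partial>M)
      = ennreal (\<integral>t. arctan ((b - t) / (1 / Suc n)) - arctan ((a - t) / (1 / Suc n)) \<partial>N)"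
      unfolding M.integral_arctan_eq[OF that y] N.integral_arctan_eq[OF that y]
      using y by (simp add: eq)
    then show ?thesis using nonneg by simp
  qed
  have diff_eq: "(\<integral>t. sgn (b - t) \<partial>M) - (\<integral>t. sgn (a - t) \<partial>M)
      = (\<integral>t. sgn (b - t) \<partial>N) - (\<integral>t. sgn (a - t) \<partial>N)" if "a \<le> b" for a b :: real
    using LIMSEQ_unique[OF M.sign_integral_diff_eq[OF that, unfolded arctan_eq[OF that]]
        N.sign_integral_diff_eq[OF that]] by simp
  have sgn_eq: "(\<integral>t. sgn (b - t) \<partial>M) = (\<integral>t. sgn (b - t) \<partial>N)" for b :: real
  proof -
    have "(\<lambda>n. (\<integral>t. sgn (- real n - t) \<partial>M) - (\<integral>t. sgn (- real n - t) \<partial>N)) \<longlonglongrightarrow> -1 - (-1)"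
      by (intro tendsto_diff M.sign_integral_at_bot N.sign_integral_at_bot)
    moreover have "\<forall>\<^sub>F n in sequentially. (\<integral>t. sgn (- real n - t) \<partial>M) - (\<integral>t. sgn (- real n - t) \<partial>N)
      = (\<integral>t. sgn (b - t) \<partial>M) - (\<integral>t. sgn (b - t) \<partial>N)"
    proof -
      obtain k :: nat where k: "- b < k" using reals_Archimedean2 by blast
      show ?thesis
      proof (rule eventually_sequentiallyI)
        fix n assume "k \<le> n"
        then have "- real n \<le> b" using k by linarith
        from diff_eq[OF this] show "(\<integral>t. sgn (- real n - t) \<partial>M) - (\<integral>t. sgn (- real n - t) \<partial>N)
          = (\<integral>t. sgn (b - t) \<partial>M) - (\<integral>t. sgn (b - t) \<partial>N)" by linarith
      qed
    qed
    ultimately have "(\<lambda>n :: nat. (\<integral>t. sgn (b - t) \<partial>M) - (\<integral>t. sgn (b - t) \<partial>N)) \<longlonglongrightarrow> -1 - (-1)"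
      by (rule Lim_transform_eventually)
    then show ?thesis using LIMSEQ_unique[OF _ tendsto_const] by fastforce
  qed
  have "cdf M x = cdf N x" for x
    using LIMSEQ_unique[OF M.sign_integral_at_right[of x, unfolded sgn_eq] N.sign_integral_at_right[of x]]
    by simp
  then show ?thesis using assms(1,2) by (intro cdf_unique) auto
qed

section \<open>Walks as iterated neighbour sums\<close>

definition incident :: "('v, 'e) multigraph \<Rightarrow> 'v \<Rightarrow> 'e set" where
  "incident G x = {d \<in> edges G. x \<in> ends G d}"

text \<open>The far end of the edge \<open>d\<close>, seen from its end \<open>x\<close>. For a loop this is \<open>x\<close> itself.\<close>

definition opposite :: "('v, 'e) multigraph \<Rightarrow> 'v \<Rightarrow> 'e \<Rightarrow> 'v" where
  "opposite G x d = (THE y. ends G d = {x, y})"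

text \<open>The adjacency operator, written as a sum over edges instead of over vertices. Multiplicities and
  loops then need no bookkeeping, and the same definition serves natural, real and complex
  functions.\<close>

definition nbr_sum :: "('v, 'e) multigraph \<Rightarrow> ('v \<Rightarrow> 'a::comm_monoid_add) \<Rightarrow> 'v \<Rightarrow> 'a" where
  "nbr_sum G g x = (if x \<in> verts G then \<Sum>d\<in>incident G x. g (opposite G x d) else 0)"

text \<open>Each neighbour sum accounts for one more initial edge, so iterating it on the indicator function
  of \<open>e\<close> counts the walks to \<open>e\<close> (\<open>finite_card_walks\<close>).\<close>

definition walk_count :: "('v, 'e) multigraph \<Rightarrow> 'v \<Rightarrow> nat \<Rightarrow> 'v \<Rightarrow> nat" where
  "walk_count G e n = (nbr_sum G ^^ n) (\<lambda>x. of_bool (x = e))"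

lemma opposite_eq: "ends G d = {x, y} \<Longrightarrow> opposite G x d = y"
  unfolding opposite_def by (rule the_equality) (auto simp: doubleton_eq_iff)

lemma nbr_sum_of_nat: "nbr_sum G (\<lambda>x. of_nat (g x)) x = of_nat (nbr_sum G g x)"
  by (simp add: nbr_sum_def)

lemma nbr_sum_funpow_eq_walk_count:
  "(nbr_sum G ^^ n) (\<lambda>x. of_bool (x = e)) = (\<lambda>x. of_nat (walk_count G e n x) :: 'a::semiring_1)"
proof (induction n)
  case 0
  show ?case by (auto simp: walk_count_def fun_eq_iff)
next
  case (Suc n)
  have "walk_count G e (Suc n) = nbr_sum G (walk_count G e n)"
    by (simp add: walk_count_def)
  then show ?case
    by (simp add: Suc.IH nbr_sum_of_nat fun_eq_iff)
qed

lemma walk_count_0: "walk_count G e 0 x = of_bool (x = e)"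
  by (simp add: walk_count_def)

lemma walk_count_Suc: "walk_count G e (Suc n) x = nbr_sum G (walk_count G e n) x"
  by (simp add: walk_count_def)

locale bounded_degree_graph =
  fixes G :: "('v, 'e) multigraph" and D :: nat
  assumes edge_ends: "d \<in> edges G \<Longrightarrow> \<exists>x\<in>verts G. \<exists>y\<in>verts G. ends G d = {x, y}"
    and finite_incident [intro, simp]: "x \<in> verts G \<Longrightarrow> finite (incident G x)"
    and card_incident_le: "x \<in> verts G \<Longrightarrow> card (incident G x) \<le> D"
begin

lemma
  assumes "d \<in> incident G x"
  shows ends_opposite: "ends G d = {x, opposite G x d}"
    and opposite_in_verts: "opposite G x d \<in> verts G"
proof -
  from assms have "d \<in> edges G" "x \<in> ends G d" by (auto simp: incident_def)
  with edge_ends obtain a b where ab: "a \<in> verts G" "b \<in> verts G" "ends G d = {a, b}" by blast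
  then obtain y where y: "ends G d = {x, y}" "y \<in> verts G"
    using \<open>x \<in> ends G d\<close> by (cases "x = a") (auto simp: insert_commute)
  show "ends G d = {x, opposite G x d}" "opposite G x d \<in> verts G"
    using y opposite_eq[OF y(1)] by simp_all
qed

lemma incident_opposite: "d \<in> incident G x \<Longrightarrow> d \<in> incident G (opposite G x d)"
  using ends_opposite[of d x] by (auto simp: incident_def)

lemma opposite_opposite: "d \<in> incident G x \<Longrightarrow> opposite G (opposite G x d) d = x"
  using ends_opposite[of d x] by (intro opposite_eq) (auto simp: insert_commute)

lemma ends_eq_iff:
  "d \<in> edges G \<and> ends G d = {x, y} \<longleftrightarrow> d \<in> incident G x \<and> opposite G x d = y"
  using ends_opposite[of d x] opposite_eq[of G d x y] by (auto simp: incident_def)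

lemma adj_op_eq_nbr_sum: "adj_op G g = nbr_sum G g"
proof
  fix x
  show "adj_op G g x = nbr_sum G g x"
  proof (cases "x \<in> verts G")
    case True
    let ?N = "opposite G x ` incident G x"
    have adj: "adj_matrix G x y = card {d \<in> incident G x. opposite G x d = y}" for y
      by (simp add: adj_matrix_def ends_eq_iff)
    have "adj_op G g x = (\<Sum>\<^sub>\<infinity>y\<in>verts G. of_nat (adj_matrix G x y) * g y)"
      using True by (simp add: adj_op_def)
    also have "\<dots> = (\<Sum>\<^sub>\<infinity>y\<in>?N. of_nat (adj_matrix G x y) * g y)"
    proof (rule infsum_cong_neutral)
      fix y assume "y \<in> verts G - ?N"
      then have "{d \<in> incident G x. opposite G x d = y} = {}" by auto
      then show "of_nat (adj_matrix G x y) * g y = 0"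
        unfolding adj by (simp only: card.empty)simp
    qed (use opposite_in_verts in auto)
    also have "\<dots> = (\<Sum>y\<in>?N. of_nat (adj_matrix G x y) * g y)"
      using True by (simp add: infsum_finite)
    also have "\<dots> = (\<Sum>y\<in>?N. \<Sum>d\<in>{d \<in> incident G x. opposite G x d = y}. g (opposite G x d))"
      by (intro sum.cong refl) (simp add: adj)
    also have "\<dots> = nbr_sum G g x"
      using True sum.image_gen[of "incident G x" "\<lambda>d. g (opposite G x d)" "opposite G x"]
      by (simp only: nbr_sum_def finite_incident if_True)
    finally show ?thesis .
  qed (simp add: adj_op_def nbr_sum_def)
qed

lemma moment_eq_walk_count:
  assumes "e \<in> verts G"
  shows "l2_inner (verts G) ((adj_op G ^^ n) (basis_vec e)) (basis_vec e)
    = of_nat (walk_count G e n e)"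
proof -
  have "adj_op G = nbr_sum G" by (rule ext) (rule adj_op_eq_nbr_sum)
  moreover have "basis_vec e = (\<lambda>x. of_bool (x = e))" by (auto simp: basis_vec_def)
  ultimately have pow: "(adj_op G ^^ n) (basis_vec e) = (\<lambda>x. of_nat (walk_count G e n x))"
    by (simp only: nbr_sum_funpow_eq_walk_count)
  have "l2_inner (verts G) (\<lambda>x. of_nat (walk_count G e n x)) (basis_vec e)
      = (\<Sum>\<^sub>\<infinity>x\<in>{e}. of_nat (walk_count G e n x) * cnj (basis_vec e x))"
    unfolding l2_inner_def
    by (rule infsum_cong_neutral) (use assms in \<open>auto simp: basis_vec_def\<close>)
  then show ?thesis unfolding pow by (simp add: basis_vec_def)
qed

text \<open>Only the term at \<open>e\<close> survives in the inner product with \<open>basis_vec e\<close>, so the moments are walk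
  counts and the infinite sums over vertices disappear.\<close>

lemma spectral_distribution_iff:
  assumes "e \<in> verts G"
  shows "spectral_distribution G e \<mu> \<longleftrightarrow> real_distribution \<mu> \<and>
    (\<forall>n. integrable \<mu> (\<lambda>x. x ^ n) \<and> (\<integral>x. x ^ n \<partial>\<mu>) = walk_count G e n e)"
  unfolding spectral_distribution_def moment_eq_walk_count[OF assms]
  by (metis of_real_eq_iff of_real_of_nat_eq)

lemma norm_nbr_sum_le:
  fixes g :: "'v \<Rightarrow> 'a::real_normed_vector" and B :: real
  assumes "\<And>x. x \<in> verts G \<Longrightarrow> norm (g x) \<le> B" "0 \<le> B"
  shows "norm (nbr_sum G g x) \<le> D * B"
proof (cases "x \<in> verts G")
  case True
  have "norm (nbr_sum G g x) \<le> (\<Sum>d\<in>incident G x. B)"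
    using True unfolding nbr_sum_def
    by (simp only: if_True) (intro sum_norm_le assms opposite_in_verts)
  also have "\<dots> \<le> D * B"
    using card_incident_le[OF True] \<open>0 \<le> B\<close> by (simp add: mult_right_mono)
  finally show ?thesis .
qed (use \<open>0 \<le> B\<close> in \<open>simp add: nbr_sum_def\<close>)

lemma walk_count_le: "real (walk_count G e n x) \<le> real D ^ n"
proof (induction n arbitrary: x)
  case (Suc n)
  have "norm (nbr_sum G (\<lambda>x. real (walk_count G e n x)) x) \<le> D * real D ^ n"
    by (rule norm_nbr_sum_le) (use Suc.IH in auto)
  then show ?case by (simp add: walk_count_Suc nbr_sum_of_nat)
qed (simp add: walk_count_0)

lemma finite_card_walks:
  assumes "e \<in> verts G" "x \<in> verts G"
  shows "finite {p. walk G x p e \<and> length p = n} \<and>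
    card {p. walk G x p e \<and> length p = n} = walk_count G e n x"
  using assms(2)
proof (induction n arbitrary: x)
  case 0
  have "{p. walk G x p e \<and> length p = 0} = (if x = e then {[]} else {})"
    using assms by auto
  then show ?case by (simp add: walk_count_0)
next
  case (Suc n)
  let ?W = "\<lambda>y. {p. walk G y p e \<and> length p = n}"
  let ?f = "\<lambda>d. (#) (d, opposite G x d) ` ?W (opposite G x d)"
  have *: "{p. walk G x p e \<and> length p = Suc n} = (\<Union>d\<in>incident G x. ?f d)" (is "?L = ?R")
  proof (intro equalityI subsetI)
    fix p assume "p \<in> ?L"
    then have p: "walk G x p e" "length p = Suc n" by simp_all
    from p(2) obtain d z q where "p = (d, z) # q" "length q = n"
      by (metis length_Suc_conv surj_pair)
    moreover from this have "d \<in> incident G x" "z = opposite G x d" "walk G z q e"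
      using p ends_eq_iff[of d x z] by simp_all
    ultimately show "p \<in> ?R" by blast
  next
    fix p assume "p \<in> ?R"
    then obtain d q where "d \<in> incident G x" "p = (d, opposite G x d) # q"
      "walk G (opposite G x d) q e" "length q = n" by blast
    then show "p \<in> ?L" using ends_eq_iff[of d x "opposite G x d"] by simp
  qed
  have fin: "finite (?f d)" and card: "card (?f d) = walk_count G e n (opposite G x d)"
    if "d \<in> incident G x" for d
    using Suc.IH[OF opposite_in_verts[OF that]] by (simp_all add: card_image)
  have "card (\<Union>d\<in>incident G x. ?f d) = (\<Sum>d\<in>incident G x. card (?f d))"
    by (rule card_UN_disjoint) (use Suc.prems fin in \<open>blast+\<close>)
  also have "\<dots> = walk_count G e (Suc n) x"
    using Suc.prems by (simp add: walk_count_Suc nbr_sum_def card)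
  finally show ?case
    unfolding * using finite_UN_I[OF finite_incident[OF Suc.prems] fin] by simp
qed

end

lemma ulf_imp_bounded_degree:
  assumes "ulf_graph G"
  obtains D where "bounded_degree_graph G D"
proof -
  interpret ulf_graph G by fact
  obtain D where "\<forall>x\<in>verts G. finite {d \<in> edges G. x \<in> ends G d}
      \<and> card {d \<in> edges G. x \<in> ends G d} \<le> D"
    using unif_loc_finite by blast
  then have "bounded_degree_graph G D"
    using ends_verts by unfold_locales (simp_all add: incident_def)
  then show thesis by (rule that)
qed

lemma bounded_degree_graph_mono:
  "bounded_degree_graph G D \<Longrightarrow> D \<le> D' \<Longrightarrow> bounded_degree_graph G D'"
  unfolding bounded_degree_graph_def by (auto intro: order_trans[of _ D D'])

section \<open>Existence of spectral distributions\<close>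

text \<open>The inner product on finitely supported functions, as a sum over the support of the product, so
  that it can be computed over any finite set that contains this support.\<close>

definition fin_inner :: "('v \<Rightarrow> real) \<Rightarrow> ('v \<Rightarrow> real) \<Rightarrow> real" where
  "fin_inner v w = (\<Sum>x | v x * w x \<noteq> 0. v x * w x)"

lemma fin_inner_eq_sum:
  assumes "finite S" "\<And>x. x \<notin> S \<Longrightarrow> v x = 0 \<or> w x = 0"
  shows "fin_inner v w = (\<Sum>x\<in>S. v x * w x)"
  unfolding fin_inner_def by (rule sum.mono_neutral_left) (use assms in auto)

lemma fin_inner_self_nonneg: "0 \<le> fin_inner v v"
  unfolding fin_inner_def by (rule sum_nonneg) simp

lemma fin_inner_commute: "fin_inner v w = fin_inner w v"
  by (simp add: fin_inner_def mult.commute)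

lemma nbr_sum_linear:
  fixes v w :: "'v \<Rightarrow> real"
  shows "nbr_sum G (\<lambda>x. a * v x + b * w x) x = a * nbr_sum G v x + b * nbr_sum G w x"
  by (simp add: nbr_sum_def sum.distrib sum_distrib_left)

context bounded_degree_graph
begin

definition fin_supp :: "('v \<Rightarrow> real) set" where
  "fin_supp = {v. finite {x. v x \<noteq> 0} \<and> {x. v x \<noteq> 0} \<subseteq> verts G}"

lemma fin_supp_nbr_sum:
  assumes "v \<in> fin_supp"
  shows "nbr_sum G v \<in> fin_supp"
proof -
  let ?S = "{x. v x \<noteq> 0}"
  let ?N = "\<Union>y\<in>?S. opposite G y ` incident G y"
  have sub: "{x. nbr_sum G v x \<noteq> 0} \<subseteq> ?N"
  proof
    fix x assume "x \<in> {x. nbr_sum G v x \<noteq> 0}"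
    then have "(\<Sum>d\<in>incident G x. v (opposite G x d)) \<noteq> 0"
      by (auto simp: nbr_sum_def split: if_splits)
    then obtain d where d: "d \<in> incident G x" "v (opposite G x d) \<noteq> 0"
      by (rule sum.not_neutral_contains_not_neutral)
    from d(2) incident_opposite[OF d(1)] opposite_opposite[OF d(1)]
    show "x \<in> ?N" by force
  qed
  have "finite ?N" using assms by (auto simp: fin_supp_def)
  moreover have "{x. nbr_sum G v x \<noteq> 0} \<subseteq> verts G"
    by (auto simp: nbr_sum_def)
  ultimately show ?thesis using finite_subset[OF sub] by (simp add: fin_supp_def)
qed

lemma fin_supp_linear:
  assumes "v \<in> fin_supp" "w \<in> fin_supp"
  shows "(\<lambda>x. a * v x + b * w x) \<in> fin_supp"
proof -
  have "{x. a * v x + b * w x \<noteq> 0} \<subseteq> {x. v x \<noteq> 0} \<union> {x. w x \<noteq> 0}" by auto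
  then show ?thesis using assms finite_subset unfolding fin_supp_def by blast
qed

lemma fin_inner_linear:
  assumes "u \<in> fin_supp"
  shows "fin_inner (\<lambda>x. a * v x + b * w x) u = a * fin_inner v u + b * fin_inner w u"
proof -
  have "finite {x. u x \<noteq> 0}" using assms by (simp add: fin_supp_def)
  then show ?thesis
    by (subst (1 2 3) fin_inner_eq_sum[of "{x. u x \<noteq> 0}"])
      (auto simp: sum.distrib sum_distrib_left algebra_simps)
qed

text \<open>Sums over oriented edges (darts). All darts that start or end in the supports of \<open>v\<close> and \<open>w\<close>
  form a finite set closed under reversal, and reversal is the whole reason for the symmetry of the
  adjacency operator. The last two equations say that this set is large enough to compute inner
  products with \<open>v\<close> and \<open>w\<close>.\<close>

lemma darts:
  assumes "v \<in> fin_supp" "w \<in> fin_supp"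
  obtains T where "finite T" "\<And>x d. (x, d) \<in> T \<Longrightarrow> d \<in> incident G x"
    "bij_betw (\<lambda>(x, d). (opposite G x d, d)) T T"
    "\<And>g. (\<Sum>(x, d)\<in>T. g x d * w x) = (\<Sum>x | w x \<noteq> 0. (\<Sum>d\<in>incident G x. g x d) * w x)"
    "\<And>g. (\<Sum>(x, d)\<in>T. g x d * v x) = (\<Sum>x | v x \<noteq> 0. (\<Sum>d\<in>incident G x. g x d) * v x)"
proof -
  let ?\<iota> = "\<lambda>(x, d). (opposite G x d, d)"
  define S where "S = {x. v x \<noteq> 0} \<union> {x. w x \<noteq> 0}"
  define E where "E = Sigma S (incident G)"
  have S: "finite S" "S \<subseteq> verts G" using assms by (auto simp: S_def fin_supp_def)
  then have finE: "finite E" unfolding E_def by (intro finite_SigmaI) auto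
  let ?T = "E \<union> ?\<iota> ` E"
  have inc: "d \<in> incident G x" if "(x, d) \<in> ?T" for x d
    using that incident_opposite by (auto simp: E_def)
  have invol: "?\<iota> (?\<iota> t) = t" if "t \<in> ?T" for t
    using that opposite_opposite inc by (cases t) auto
  have maps: "?\<iota> t \<in> ?T" if "t \<in> ?T" for t
    using that opposite_opposite by (auto simp: E_def image_iff)
  have bij: "bij_betw ?\<iota> ?T ?T"
    by (rule bij_betwI[where g = ?\<iota>]) (use maps invol in auto)
  have sum: "(\<Sum>(x, d)\<in>?T. g x d * u x) = (\<Sum>x | u x \<noteq> 0. (\<Sum>d\<in>incident G x. g x d) * u x)"
    if u: "{x. u x \<noteq> 0} \<subseteq> S" for g and u :: "'v \<Rightarrow> real"
  proof -
    have "(\<Sum>(x, d)\<in>?T. g x d * u x) = (\<Sum>(x, d)\<in>Sigma {x. u x \<noteq> 0} (incident G). g x d * u x)"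
    proof (rule sum.mono_neutral_right)
      show "finite ?T" using finE by simp
      show "Sigma {x. u x \<noteq> 0} (incident G) \<subseteq> ?T" using u by (auto simp: E_def)
      show "\<forall>t\<in>?T - Sigma {x. u x \<noteq> 0} (incident G). (case t of (x, d) \<Rightarrow> g x d * u x) = 0"
      proof
        fix t assume t: "t \<in> ?T - Sigma {x. u x \<noteq> 0} (incident G)"
        obtain x d where "t = (x, d)" by (cases t)
        with t inc[of x d] show "(case t of (x, d) \<Rightarrow> g x d * u x) = 0" by auto
      qed
    qed
    also have "\<dots> = (\<Sum>x | u x \<noteq> 0. \<Sum>d\<in>incident G x. g x d * u x)"
      by (rule sum.Sigma[symmetric]) (use S u finite_subset in auto)
    finally show ?thesis by (simp add: sum_distrib_right)
  qed
  show thesis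
    by (rule that[of ?T]) (use finE inc bij sum in \<open>auto simp: S_def\<close>)
qed

lemma fin_inner_nbr_sum_commute:
  assumes "v \<in> fin_supp" "w \<in> fin_supp"
  shows "fin_inner (nbr_sum G v) w = fin_inner v (nbr_sum G w)"
proof -
  obtain T where T: "finite T" "\<And>x d. (x, d) \<in> T \<Longrightarrow> d \<in> incident G x"
    "bij_betw (\<lambda>(x, d). (opposite G x d, d)) T T"
    "\<And>g. (\<Sum>(x, d)\<in>T. g x d * w x) = (\<Sum>x | w x \<noteq> 0. (\<Sum>d\<in>incident G x. g x d) * w x)"
    "\<And>g. (\<Sum>(x, d)\<in>T. g x d * v x) = (\<Sum>x | v x \<noteq> 0. (\<Sum>d\<in>incident G x. g x d) * v x)"
    by (rule darts[OF assms]) blast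
  have *: "fin_inner (nbr_sum G p) q = (\<Sum>x | q x \<noteq> 0. (\<Sum>d\<in>incident G x. p (opposite G x d)) * q x)"
    if "q \<in> fin_supp" for p q
    by (subst fin_inner_eq_sum[of "{x. q x \<noteq> 0}"]) (use that in \<open>auto simp: fin_supp_def nbr_sum_def intro!: sum.cong\<close>)
  have "fin_inner (nbr_sum G v) w = (\<Sum>(x, d)\<in>T. v (opposite G x d) * w x)"
    unfolding *[OF assms(2)] by (rule T(4)[symmetric])
  also have "\<dots> = (\<Sum>(x, d)\<in>T. v (opposite G (opposite G x d) d) * w (opposite G x d))"
    by (subst sum.reindex_bij_betw[OF T(3), symmetric]) (simp add: case_prod_beta)
  also have "\<dots> = (\<Sum>(x, d)\<in>T. w (opposite G x d) * v x)"
    by (rule sum.cong) (auto simp: opposite_opposite T(2))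
  also have "\<dots> = fin_inner (nbr_sum G w) v"
    unfolding *[OF assms(1)] by (rule T(5))
  finally show ?thesis by (simp only: fin_inner_commute)
qed

text \<open>The sums over darts of \<open>(v y + v x)\<^sup>2\<close> and of \<open>(v y - v x)\<^sup>2\<close> are nonnegative, where \<open>x\<close> and
  \<open>y\<close> are the two ends. The pure squares contribute at most \<open>2 * D\<close> times the squared norm,
  the mixed terms plus or minus twice the quadratic form.\<close>

lemma abs_fin_inner_nbr_sum_le:
  assumes "v \<in> fin_supp"
  shows "\<bar>fin_inner (nbr_sum G v) v\<bar> \<le> D * fin_inner v v"
proof -
  obtain T where T: "finite T" "\<And>x d. (x, d) \<in> T \<Longrightarrow> d \<in> incident G x"
    "bij_betw (\<lambda>(x, d). (opposite G x d, d)) T T"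
    "\<And>g. (\<Sum>(x, d)\<in>T. g x d * v x) = (\<Sum>x | v x \<noteq> 0. (\<Sum>d\<in>incident G x. g x d) * v x)"
    by (rule darts[OF assms assms]) blast
  have fin: "finite {x. v x \<noteq> 0}" and sub: "\<And>x. v x \<noteq> 0 \<Longrightarrow> x \<in> verts G"
    using assms by (auto simp: fin_supp_def)
  have fin_inner: "fin_inner (nbr_sum G v) v = (\<Sum>(x, d)\<in>T. v (opposite G x d) * v x)"
    unfolding T(4)
    by (subst fin_inner_eq_sum[of "{x. v x \<noteq> 0}"]) (use fin sub in \<open>auto simp: nbr_sum_def intro!: sum.cong\<close>)
  have sq: "(\<Sum>(x, d)\<in>T. (v (opposite G x d))\<^sup>2) = (\<Sum>(x, d)\<in>T. (v x)\<^sup>2)"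
    by (subst sum.reindex_bij_betw[OF T(3), symmetric])
      (auto simp: opposite_opposite T(2) intro!: sum.cong)
  have "(\<Sum>(x, d)\<in>T. (v x)\<^sup>2) = (\<Sum>x | v x \<noteq> 0. (\<Sum>d\<in>incident G x. v x) * v x)"
    by (subst T(4)[symmetric]) (simp add: power2_eq_square)
  also have "\<dots> = (\<Sum>x | v x \<noteq> 0. card (incident G x) * (v x * v x))"
    by (simp add: algebra_simps)
  also have "\<dots> \<le> (\<Sum>x | v x \<noteq> 0. D * (v x * v x))"
    using card_incident_le sub by (intro sum_mono mult_right_mono) auto
  also have "\<dots> = D * fin_inner v v"
    by (subst fin_inner_eq_sum[of "{x. v x \<noteq> 0}"]) (use fin in \<open>auto simp: sum_distrib_left\<close>)
  finally have le: "(\<Sum>(x, d)\<in>T. (v x)\<^sup>2) \<le> D * fin_inner v v" .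
  have "0 \<le> (\<Sum>(x, d)\<in>T. (v (opposite G x d) + s * v x)\<^sup>2)" for s
    by (auto intro: sum_nonneg)
  also have "(\<Sum>(x, d)\<in>T. (v (opposite G x d) + s * v x)\<^sup>2)
     = (\<Sum>(x, d)\<in>T. (v (opposite G x d))\<^sup>2) + 2 * s * (\<Sum>(x, d)\<in>T. v (opposite G x d) * v x)
       + s\<^sup>2 * (\<Sum>(x, d)\<in>T. (v x)\<^sup>2)" for s
    by (simp add: sum_distrib_left sum.distrib[symmetric] case_prod_beta power2_sum algebra_simps)
  finally have "0 \<le> (1 + s\<^sup>2) * (\<Sum>(x, d)\<in>T. (v x)\<^sup>2) + 2 * s * fin_inner (nbr_sum G v) v" for s
    unfolding sq fin_inner by (simp add: algebra_simps)
  from this[of 1] this[of "-1"] le show ?thesis by simp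
qed

text \<open>Since \<open>- K \<le> A \<le> K\<close>, the operators \<open>P = K + A\<close> and \<open>Q = K - A\<close> are positive, they commute,
  and \<open>P + Q = 2 * K\<close>. Hence \<open>c k j = \<langle>P ^ k Q ^ j \<delta>, \<delta>\<rangle> / (2 * K) ^ (k + j)\<close> satisfies the
  hypotheses of \<open>hausdorff_moment_problem\<close>, and the solution is the distribution of
  \<open>P / (2 * K)\<close> in the state \<open>\<delta>\<close>. The affine image \<open>2 * K * t - K\<close> of the solution is the
  spectral distribution of \<open>A\<close>.\<close>

lemma exists_spectral_distribution:
  assumes e: "e \<in> verts G"
  shows "\<exists>\<mu>. spectral_distribution G e \<mu>"
proof -
  \<comment> \<open>One more than the degree bound, to have \<open>K > 0\<close> also for graphs without edges.\<close>
  define K where "K = real D + 1"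
  have K: "K > 0" "K \<ge> D" by (simp_all add: K_def)
  define A :: "('v \<Rightarrow> real) \<Rightarrow> ('v \<Rightarrow> real)" where "A = nbr_sum G"
  \<comment> \<open>The factors \<open>1\<close> and \<open>- 1\<close> keep both operators in the shape of the linearity lemmas.\<close>
  define P where "P v = (\<lambda>x. K * v x + 1 * A v x)" for v
  define Q where "Q v = (\<lambda>x. K * v x + (- 1) * A v x)" for v
  define \<delta> :: "'v \<Rightarrow> real" where "\<delta> = (\<lambda>x. of_bool (x = e))"
  define X where "X k j = (P ^^ k) ((Q ^^ j) \<delta>)" for k j
  have \<delta>: "\<delta> \<in> fin_supp" using e by (auto simp: fin_supp_def \<delta>_def)
  have A_fin_supp: "A v \<in> fin_supp" if "v \<in> fin_supp" for v using fin_supp_nbr_sum[OF that] by (simp add: A_def)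
  have P_fin_supp: "P v \<in> fin_supp" and Q_fin_supp: "Q v \<in> fin_supp" if "v \<in> fin_supp" for v
    unfolding P_def Q_def by (intro fin_supp_linear that A_fin_supp)+
  have X_fin_supp: "X k j \<in> fin_supp" for k j
  proof -
    have "(Q ^^ j) \<delta> \<in> fin_supp" by (induction j) (simp_all add: \<delta> Q_fin_supp)
    then show ?thesis unfolding X_def by (induction k) (simp_all add: P_fin_supp)
  qed
  have PQ: "P (Q v) = Q (P v)" for v
    unfolding P_def Q_def A_def by (simp only: nbr_sum_linear) (simp add: algebra_simps)
  have PX: "P (X k j) = X (Suc k) j" for k j by (simp add: X_def)
  have QX: "Q (X k j) = X k (Suc j)" for k j
    unfolding X_def by (induction k) (simp_all add: PQ[symmetric])
  have sum_PQ: "fin_inner (P v) w + fin_inner (Q v) w = 2 * K * fin_inner v w" if "v \<in> fin_supp" "w \<in> fin_supp" for v w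
    unfolding P_def Q_def by (simp only: fin_inner_linear that A_fin_supp)
  have P_sym: "fin_inner (P v) w = fin_inner v (P w)" and Q_sym: "fin_inner (Q v) w = fin_inner v (Q w)"
    if "v \<in> fin_supp" "w \<in> fin_supp" for v w
  proof -
    have *: "fin_inner v (\<lambda>x. K * w x + s * A w x) = K * fin_inner v w + s * fin_inner v (A w)" for s
      unfolding fin_inner_commute[of v] by (rule fin_inner_linear) (use that A_fin_supp in auto)
    have "fin_inner (A v) w = fin_inner v (A w)"
      unfolding A_def by (rule fin_inner_nbr_sum_commute[OF that])
    then show "fin_inner (P v) w = fin_inner v (P w)" "fin_inner (Q v) w = fin_inner v (Q w)"
      unfolding P_def Q_def * using that A_fin_supp by (simp_all only: fin_inner_linear)
  qed
  have P_pos: "0 \<le> fin_inner (P v) v" and Q_pos: "0 \<le> fin_inner (Q v) v" if v: "v \<in> fin_supp" for v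
  proof -
    have "\<bar>fin_inner (A v) v\<bar> \<le> K * fin_inner v v"
      using abs_fin_inner_nbr_sum_le[OF v] mult_right_mono[OF K(2) fin_inner_self_nonneg[of v]]
      by (simp add: A_def)
    then show "0 \<le> fin_inner (P v) v" "0 \<le> fin_inner (Q v) v"
      unfolding P_def Q_def by (simp_all only: fin_inner_linear[OF v])
  qed
  have shift: "fin_inner (X (k + k') (j + j')) \<delta> = fin_inner (X k j) (X k' j')" for k k' j j'
  proof -
    have Ps: "fin_inner (X (k + k') j) (X 0 l) = fin_inner (X k j) (X k' l)" for k j l
    proof (induction k' arbitrary: k)
      case (Suc k')
      have "fin_inner (X (k + Suc k') j) (X 0 l) = fin_inner (X (Suc k) j) (X k' l)"
        using Suc.IH[of "Suc k"] by simp
      also have "\<dots> = fin_inner (X k j) (X (Suc k') l)"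
        by (simp only: PX[symmetric] P_sym X_fin_supp)
      finally show ?case .
    qed simp
    have Qs: "fin_inner (X k (j + j')) (X 0 0) = fin_inner (X k j) (X 0 j')" for k j
    proof (induction j' arbitrary: j)
      case (Suc j')
      have "fin_inner (X k (j + Suc j')) (X 0 0) = fin_inner (X k (Suc j)) (X 0 j')"
        using Suc.IH[of "Suc j"] by simp
      also have "\<dots> = fin_inner (X k j) (X 0 (Suc j'))"
        by (simp only: QX[symmetric] Q_sym X_fin_supp)
      finally show ?case .
    qed simp
    have "\<delta> = X 0 0" by (simp add: X_def)
    then show ?thesis by (simp only: Qs Ps)
  qed
  \<comment> \<open>If both exponents are even, the value is a squared norm; if one is odd, it is a quadratic form of
    \<open>P\<close> or \<open>Q\<close>. If both are odd, it is a quadratic form of \<open>P Q\<close>, and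
    \<open>2 * K * P Q = P Q (P + Q) = P Q P + Q P Q\<close> is positive.\<close>
  have X_pos: "0 \<le> fin_inner (X k j) \<delta>" for k j
  proof -
    define k' j' where "k' = k div 2" and "j' = j div 2"
    let ?Y = "X k' j'"
    have cases: "(k = k' + k' \<or> k = Suc k' + k') \<and> (j = j' + j' \<or> j = Suc j' + j')"
      unfolding k'_def j'_def by presburger
    have PQY: "0 \<le> fin_inner (P (Q ?Y)) ?Y"
    proof -
      have "2 * K * fin_inner (P (Q ?Y)) ?Y = fin_inner (P (P (Q ?Y))) ?Y + fin_inner (Q (P (Q ?Y))) ?Y"
        by (rule sum_PQ[symmetric]) (intro P_fin_supp Q_fin_supp X_fin_supp)+
      also have "fin_inner (P (P (Q ?Y))) ?Y = fin_inner (Q (P ?Y)) (P ?Y)"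
        by (simp only: PQ[of ?Y] P_sym[OF Q_fin_supp[OF P_fin_supp[OF X_fin_supp]] X_fin_supp])
      also have "fin_inner (Q (P (Q ?Y))) ?Y = fin_inner (P (Q ?Y)) (Q ?Y)"
        by (rule Q_sym[OF P_fin_supp[OF Q_fin_supp[OF X_fin_supp]] X_fin_supp])
      finally have "0 \<le> 2 * K * fin_inner (P (Q ?Y)) ?Y"
        using Q_pos[OF P_fin_supp[OF X_fin_supp]] P_pos[OF Q_fin_supp[OF X_fin_supp]] by simp
      then show ?thesis using K(1) by (simp add: zero_le_mult_iff)
    qed
    from cases have "fin_inner (X k j) \<delta> \<in> {fin_inner ?Y ?Y, fin_inner (P ?Y) ?Y, fin_inner (Q ?Y) ?Y, fin_inner (P (Q ?Y)) ?Y}"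
      unfolding PX QX by (auto simp only: shift insert_iff)
    then show ?thesis
      using fin_inner_self_nonneg[of ?Y] P_pos[OF X_fin_supp, of k' j'] Q_pos[OF X_fin_supp, of k' j'] PQY by auto
  qed
  define c where "c k j = fin_inner (X k j) \<delta> / (2 * K) ^ (k + j)" for k j
  have c_nonneg: "0 \<le> c k j" for k j
    using X_pos K(1) by (simp add: c_def)
  have pascal: "c k j = c (Suc k) j + c k (Suc j)" for k j
  proof -
    have "c (Suc k) j + c k (Suc j) = (2 * K * fin_inner (X k j) \<delta>) / (2 * K) ^ (Suc (k + j))"
      unfolding sum_PQ[OF X_fin_supp \<delta>, symmetric] PX QX c_def by (simp add: add_divide_distrib)
    then show ?thesis using K(1) by (simp add: c_def)
  qed
  have fin_inner_\<delta>: "fin_inner v \<delta> = v e" for v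
    by (subst fin_inner_eq_sum[of "{e}"]) (auto simp: \<delta>_def)
  have "c 0 0 = 1"
    by (simp add: c_def X_def fin_inner_\<delta>) (simp add: \<delta>_def)
  obtain M where M: "real_distribution M" "AE x in M. x \<in> {0..1}"
    and M_mom: "\<And>k. (\<integral>x. x ^ k \<partial>M) = c k 0"
    by (rule hausdorff_moment_problem[of c, OF c_nonneg pascal \<open>c 0 0 = 1\<close>]) blast
  interpret M: real_distribution M by fact
  have int: "integrable M f" if "continuous_on UNIV f" for f :: "real \<Rightarrow> real"
  proof -
    have "compact (f ` {0..1})"
      by (intro compact_continuous_image compact_Icc continuous_on_subset[OF that]) auto
    then obtain B where "\<forall>y\<in>f ` {0..1}. norm y \<le> B"
      using bounded_iff compact_imp_bounded by blast
    then have "AE x in M. norm (f x) \<le> B" using M(2) by auto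
    moreover have "f \<in> borel_measurable M"
      using borel_measurable_continuous_onI[OF that] by simp
    ultimately show ?thesis by (intro M.integrable_const_bound)
  qed
  \<comment> \<open>Carrying the power of \<open>t\<close> along makes the induction work: \<open>A\<close> maps \<open>P ^ k \<delta>\<close> to
    \<open>P ^ (k + 1) \<delta> - K * P ^ k \<delta>\<close>.\<close>
  have moments: "fin_inner ((A ^^ n) (X k 0)) \<delta> = (2 * K) ^ k * (\<integral>t. (2 * K * t - K) ^ n * t ^ k \<partial>M)" for n k
  proof (induction n arbitrary: k)
    case 0
    show ?case using K(1) M_mom[of k] by (simp add: c_def)
  next
    case (Suc n)
    have lin: "(A ^^ n) (\<lambda>x. a * v x + b * w x) = (\<lambda>x. a * (A ^^ n) v x + b * (A ^^ n) w x)"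
      for a b v w
      by (induction n) (simp_all add: A_def nbr_sum_linear)
    have AX: "A (X k 0) = (\<lambda>x. 1 * X (Suc k) 0 x + (- K) * X k 0 x)"
      by (simp add: PX[symmetric] P_def)
    have "(A ^^ Suc n) (X k 0) e = (A ^^ n) (A (X k 0)) e"
      by (simp only: funpow_Suc_right o_apply)
    also have "\<dots> = (A ^^ n) (X (Suc k) 0) e - K * (A ^^ n) (X k 0) e"
      unfolding AX lin by simp
    also have "\<dots> = (2 * K) ^ k * (2 * K * (\<integral>t. (2 * K * t - K) ^ n * t ^ Suc k \<partial>M)
        - K * (\<integral>t. (2 * K * t - K) ^ n * t ^ k \<partial>M))"
      using Suc.IH[of k] Suc.IH[of "Suc k"] by (simp add: fin_inner_\<delta> algebra_simps)
    also have "2 * K * (\<integral>t. (2 * K * t - K) ^ n * t ^ Suc k \<partial>M)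
        - K * (\<integral>t. (2 * K * t - K) ^ n * t ^ k \<partial>M)
      = (\<integral>t. 2 * K * ((2 * K * t - K) ^ n * t ^ Suc k) - K * ((2 * K * t - K) ^ n * t ^ k) \<partial>M)"
      by (subst Bochner_Integration.integral_diff) (auto intro!: int continuous_intros)
    also have "\<dots> = (\<integral>t. (2 * K * t - K) ^ Suc n * t ^ k \<partial>M)"
      by (rule Bochner_Integration.integral_cong) (simp_all add: algebra_simps)
    finally show ?case by (simp only: fin_inner_\<delta>)
  qed
  define \<mu> where "\<mu> = distr M borel (\<lambda>t. 2 * K * t - K)"
  have meas: "(\<lambda>t. 2 * K * t - K) \<in> measurable M borel" by measurable
  have "real_distribution \<mu>"
    unfolding \<mu>_def by (rule M.real_distribution_distr) (use meas in simp)
  moreover have "integrable \<mu> (\<lambda>x. x ^ n)" for n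
    unfolding \<mu>_def by (subst integrable_distr_eq) (auto intro!: int continuous_intros)
  moreover have "(\<integral>x. x ^ n \<partial>\<mu>) = walk_count G e n e" for n
  proof -
    have "(\<integral>x. x ^ n \<partial>\<mu>) = (\<integral>t. (2 * K * t - K) ^ n \<partial>M)"
      unfolding \<mu>_def by (rule integral_distr) auto
    also have "\<dots> = (A ^^ n) \<delta> e"
      using moments[of n 0] by (simp add: fin_inner_\<delta> X_def)
    also have "\<dots> = walk_count G e n e"
      unfolding A_def \<delta>_def nbr_sum_funpow_eq_walk_count ..
    finally show ?thesis .
  qed
  ultimately show ?thesis
    using spectral_distribution_iff[OF e] by blast
qed

end

section \<open>The Green function far from the origin\<close>

text \<open>The Neumann series of \<open>(z - A)\<^sup>-\<^sup>1 \<delta>\<close>, where \<open>\<delta>\<close> sits at \<open>e\<close>. At the vertex \<open>e\<close> itself it is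
  the moment series of the spectral distribution.\<close>

definition green :: "('v, 'e) multigraph \<Rightarrow> 'v \<Rightarrow> complex \<Rightarrow> 'v \<Rightarrow> complex" where
  "green G e z x = (\<Sum>n. of_nat (walk_count G e n x) / z ^ (n + 1))"

context bounded_degree_graph
begin

lemma
  assumes z: "norm z > D"
  shows green_sums: "(\<lambda>n. of_nat (walk_count G e n x) / z ^ (n + 1)) sums green G e z x"
    and norm_green_le: "norm (green G e z x) \<le> 1 / (norm z - D)"
proof -
  let ?f = "\<lambda>n. of_nat (walk_count G e n x) / z ^ (n + 1)"
  have z0: "norm z > 0" using z by (rule le_less_trans[OF of_nat_0_le_iff])
  have le: "norm (?f n) \<le> 1 / norm z * (D / norm z) ^ n" for n
    using walk_count_le[of e n x] z0
    by (simp add: norm_divide norm_mult norm_power power_divide divide_right_mono mult.commute)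
  have geo: "(\<lambda>n. 1 / norm z * (D / norm z) ^ n) sums (1 / norm z * (1 / (1 - D / norm z)))"
    using z z0 by (intro sums_mult geometric_sums) simp
  have eq: "1 / norm z * (1 / (1 - D / norm z)) = 1 / (norm z - D)"
    using z z0 by (simp add: field_simps)
  have sn: "summable (\<lambda>n. norm (?f n))"
    by (rule summable_comparison_test'[OF sums_summable[OF geo], of 0]) (simp only: real_norm_def abs_norm_cancel le)
  show "?f sums green G e z x"
    unfolding green_def by (rule summable_sums[OF summable_norm_cancel[OF sn]])
  have "norm (green G e z x) \<le> (\<Sum>n. norm (?f n))"
    unfolding green_def by (rule summable_norm[OF sn])
  also have "\<dots> \<le> (\<Sum>n. 1 / norm z * (D / norm z) ^ n)"
    by (rule suminf_le[OF le sn sums_summable[OF geo]])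
  finally show "norm (green G e z x) \<le> 1 / (norm z - D)"
    unfolding sums_unique[OF geo, symmetric] eq .
qed

lemma green_eq:
  assumes z: "norm z > D"
  shows "z * green G e z x = of_bool (x = e) + nbr_sum G (green G e z) x"
proof -
  let ?f = "\<lambda>n x. of_nat (walk_count G e n x) / z ^ (n + 1)"
  have z0: "z \<noteq> 0" using z by auto
  have "(\<lambda>n. z * ?f n x) sums (z * green G e z x)"
    by (rule sums_mult[OF green_sums[OF z]])
  then have "(\<lambda>n. z * ?f (Suc n) x) sums (z * green G e z x - z * ?f 0 x)"
    by (subst sums_Suc_iff) simp
  moreover have "(\<lambda>n. z * ?f (Suc n) x) = (\<lambda>n. nbr_sum G (?f n) x)"
    using z0 by (simp add: walk_count_Suc nbr_sum_def sum_divide_distrib[symmetric] fun_eq_iff)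
  ultimately have "(\<lambda>n. nbr_sum G (?f n) x) sums (z * green G e z x - z * ?f 0 x)"
    by simp
  moreover have "(\<lambda>n. nbr_sum G (?f n) x) sums nbr_sum G (green G e z) x"
    unfolding nbr_sum_def
    by (cases "x \<in> verts G") (simp_all only: if_True if_False sums_zero sums_sum[OF green_sums[OF z]])
  ultimately have "z * green G e z x - z * ?f 0 x = nbr_sum G (green G e z) x"
    by (rule sums_unique2)
  then show ?thesis using z0 by (simp add: walk_count_0 algebra_simps)
qed

text \<open>The difference \<open>w\<close> of two bounded solutions satisfies \<open>z * w = A w\<close>, so its supremum is
  at most \<open>D / |z| < 1\<close> times itself. Boundedness is essential: on an infinite graph there may be
  unbounded solutions.\<close>

lemma green_unique:
  assumes z: "norm z > D" and "x \<in> verts G"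
    and bdd: "\<And>x. x \<in> verts G \<Longrightarrow> norm (u x) \<le> B"
    and eq: "\<And>x. x \<in> verts G \<Longrightarrow> z * u x = of_bool (x = e) + nbr_sum G u x"
  shows "u x = green G e z x"
proof -
  define w where "w x = u x - green G e z x" for x
  define K where "K = B + 1 / (norm z - D)"
  have z0: "norm z > 0" using z by (rule le_less_trans[OF of_nat_0_le_iff])
  have weq: "z * w x = nbr_sum G w x" if "x \<in> verts G" for x
    using eq[OF that] green_eq[OF z, of e x]
    by (simp add: w_def nbr_sum_def sum_subtractf algebra_simps)
  have wK: "norm (w x) \<le> K" if "x \<in> verts G" for x
    unfolding w_def K_def
    using norm_triangle_ineq4[of "u x" "green G e z x"] bdd[OF that] norm_green_le[OF z, of e x]
    by linarith
  have K0: "K \<ge> 0" by (rule order_trans[OF norm_ge_zero wK[OF \<open>x \<in> verts G\<close>]])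
  have wn: "norm (w x) \<le> K * (D / norm z) ^ n" if "x \<in> verts G" for x n
    using that
  proof (induction n arbitrary: x)
    case (Suc n)
    have "norm z * norm (w x) = norm (nbr_sum G w x)"
      using weq[OF Suc.prems] by (simp flip: norm_mult)
    also have "\<dots> \<le> D * (K * (D / norm z) ^ n)"
      by (rule norm_nbr_sum_le) (use Suc.IH K0 in auto)
    finally show ?case using z0 by (simp add: field_simps)
  qed (simp add: wK)
  have "(\<lambda>n. K * (D / norm z) ^ n) \<longlonglongrightarrow> K * 0"
    using z z0 by (intro tendsto_mult tendsto_const LIMSEQ_power_zero) simp
  then have "norm (w x) \<le> K * 0"
    by (rule LIMSEQ_le_const) (use wn[OF \<open>x \<in> verts G\<close>] in blast)
  then show ?thesis by (simp add: w_def)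
qed

end

section \<open>Gluing\<close>

lemma incident_glue:
  assumes "x \<in> verts G1"
  shows "incident (glue G1 e1 G2 e2 f2) (x, y) =
    (if y = (if x = e1 then e2 else f2) then Inl ` incident G1 x else {})
      \<union> (\<lambda>d. Inr (x, d)) ` incident G2 y"
proof (intro set_eqI)
  fix c
  show "c \<in> incident (glue G1 e1 G2 e2 f2) (x, y) \<longleftrightarrow>
    c \<in> (if y = (if x = e1 then e2 else f2) then Inl ` incident G1 x else {})
      \<union> (\<lambda>d. Inr (x, d)) ` incident G2 y"
    using assms by (cases c) (auto simp: incident_def glue_def image_iff)
qed

lemma bounded_degree_glue:
  fixes G1 :: "('v1, 'e1) multigraph" and G2 :: "('v2, 'e2) multigraph"
  assumes "bounded_degree_graph G1 D1" "bounded_degree_graph G2 D2"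
    and "e2 \<in> verts G2" "f2 \<in> verts G2"
  shows "bounded_degree_graph (glue G1 e1 G2 e2 f2) (D1 + D2)"
proof -
  interpret G1: bounded_degree_graph G1 D1 by fact
  interpret G2: bounded_degree_graph G2 D2 by fact
  show ?thesis
  proof
    fix c assume c: "c \<in> edges (glue G1 e1 G2 e2 f2)"
    show "\<exists>p\<in>verts (glue G1 e1 G2 e2 f2). \<exists>q\<in>verts (glue G1 e1 G2 e2 f2).
      ends (glue G1 e1 G2 e2 f2) c = {p, q}"
    proof (cases c)
      case (Inl d)
      with c have "d \<in> edges G1" by (auto simp: glue_def)
      then obtain x y where "x \<in> verts G1" "y \<in> verts G1" "ends G1 d = {x, y}"
        using G1.edge_ends by blast
      then show ?thesis
        using assms(3,4) unfolding Inl
        by (intro bexI[of _ "(x, if x = e1 then e2 else f2)"] bexI[of _ "(y, if y = e1 then e2 else f2)"])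
          (auto simp: glue_def)
    next
      case (Inr xd)
      with c obtain x d where xd: "xd = (x, d)" "x \<in> verts G1" "d \<in> edges G2"
        by (auto simp: glue_def)
      then obtain y y' where "y \<in> verts G2" "y' \<in> verts G2" "ends G2 d = {y, y'}"
        using G2.edge_ends[of d] by blast
      then show ?thesis
        using xd unfolding Inr
        by (intro bexI[of _ "(x, y)"] bexI[of _ "(x, y')"]) (auto simp: glue_def)
    qed
  next
    fix p assume "p \<in> verts (glue G1 e1 G2 e2 f2)"
    then obtain x y where p: "p = (x, y)" "x \<in> verts G1" "y \<in> verts G2"
      by (auto simp: glue_def)
    show "finite (incident (glue G1 e1 G2 e2 f2) p)"
      using p by (simp add: incident_glue)
    let ?L = "if y = (if x = e1 then e2 else f2)
      then Inl ` incident G1 x else ({} :: ('e1 + 'v1 \<times> 'e2) set)"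
    let ?R = "(\<lambda>d. Inr (x, d) :: 'e1 + 'v1 \<times> 'e2) ` incident G2 y"
    have "card (incident (glue G1 e1 G2 e2 f2) p) \<le> card ?L + card ?R"
      unfolding p(1) incident_glue[OF p(2)] by (rule card_Un_le)
    also have "card ?L \<le> D1"
      using G1.card_incident_le[OF p(2)] by (simp add: card_image)
    also have "card ?R \<le> D2"
      using card_image_le[OF G2.finite_incident[OF p(3)]] G2.card_incident_le[OF p(3)]
      by (rule order_trans)
    finally show "card (incident (glue G1 e1 G2 e2 f2) p) \<le> D1 + D2" by simp
  qed
qed

text \<open>Edges of the first graph are seen only from the gluing vertices; edges of the copies of the second
  graph stay within their copy.\<close>

lemma nbr_sum_glue:
  fixes G1 :: "('v1, 'e1) multigraph" and G2 :: "('v2, 'e2) multigraph"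
  assumes "bounded_degree_graph G1 D1" "bounded_degree_graph G2 D2"
    and x: "x \<in> verts G1" and y: "y \<in> verts G2"
  shows "nbr_sum (glue G1 e1 G2 e2 f2) u (x, y) =
    (if y = (if x = e1 then e2 else f2)
     then nbr_sum G1 (\<lambda>x'. u (x', if x' = e1 then e2 else f2)) x else 0)
    + nbr_sum G2 (\<lambda>y'. u (x, y')) y"
proof -
  interpret G1: bounded_degree_graph G1 D1 by fact
  interpret G2: bounded_degree_graph G2 D2 by fact
  let ?G = "glue G1 e1 G2 e2 f2" and ?r = "\<lambda>x. if x = e1 then e2 else f2"
  let ?L = "if y = ?r x then Inl ` incident G1 x else ({} :: ('e1 + 'v1 \<times> 'e2) set)"
  let ?R = "(\<lambda>d. Inr (x, d) :: 'e1 + 'v1 \<times> 'e2) ` incident G2 y"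
  let ?h = "\<lambda>c. u (opposite ?G (x, y) c)"
  have L: "opposite ?G (x, ?r x) (Inl d) = (opposite G1 x d, ?r (opposite G1 x d))"
    if "d \<in> incident G1 x" for d
    using G1.ends_opposite[OF that] by (intro opposite_eq) (auto simp: glue_def)
  have R: "opposite ?G (x, y) (Inr (x, d)) = (x, opposite G2 y d)"
    if "d \<in> incident G2 y" for d
    using G2.ends_opposite[OF that] by (intro opposite_eq) (auto simp: glue_def)
  have "(x, y) \<in> verts ?G" using x y by (simp add: glue_def)
  then have "nbr_sum ?G u (x, y) = sum ?h (?L \<union> ?R)"
    unfolding nbr_sum_def incident_glue[OF x] by (simp only: if_True)
  also have "\<dots> = sum ?h ?L + sum ?h ?R"
    using x y by (intro sum.union_disjoint) auto
  also have "sum ?h ?L = (if y = ?r x then nbr_sum G1 (\<lambda>x'. u (x', ?r x')) x else 0)"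
  proof (cases "y = ?r x")
    case True
    have "sum ?h (Inl ` incident G1 x) = (\<Sum>d\<in>incident G1 x. ?h (Inl d))"
      by (subst sum.reindex) auto
    also have "\<dots> = nbr_sum G1 (\<lambda>x'. u (x', ?r x')) x"
      using x L by (simp only: nbr_sum_def True if_True cong: sum.cong)
    finally show ?thesis by (simp only: if_P[OF True])
  next
    case False
    then show ?thesis by (simp only: if_not_P sum.empty simp_thms)
  qed
  also have "sum ?h ?R = (\<Sum>d\<in>incident G2 y. ?h (Inr (x, d)))"
    by (subst sum.reindex) (auto simp: inj_on_def)
  also have "\<dots> = nbr_sum G2 (\<lambda>y'. u (x, y')) y"
    using y R by (simp only: nbr_sum_def if_True cong: sum.cong)
  finally show ?thesis .
qed

text \<open>The solution \<open>u\<close> on the glued graph is built from its values \<open>h\<close> at the gluing vertices: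
  on the copy attached at \<open>x\<close> it is the resolvent vector of the second graph based at \<open>r x\<close>, scaled
  to take the value \<open>h x\<close> there. Then \<open>h\<close> has to solve the equation of the first graph at the
  point \<open>F\<nu>\<close> except for a changed coefficient at \<open>e1\<close>, and a multiple \<open>\<kappa>\<close> of the
  resolvent vector of the first graph does so.\<close>

lemma green_glue:
  fixes z :: complex
  assumes G1: "bounded_degree_graph G1 D" and G2: "bounded_degree_graph G2 D"
    and e1: "e1 \<in> verts G1" and e2: "e2 \<in> verts G2" and f2: "f2 \<in> verts G2"
    and z: "norm z > 2 * D"
    and F1: "F1 = 1 / green G1 e1 F\<nu> e1" "green G1 e1 F\<nu> e1 \<noteq> 0"
    and F2: "F2 = 1 / green G2 e2 z e2" "green G2 e2 z e2 \<noteq> 0"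
    and F\<nu>: "F\<nu> = 1 / green G2 f2 z f2" "green G2 f2 z f2 \<noteq> 0" "norm F\<nu> > D"
    and nz: "F1 + F2 - F\<nu> \<noteq> 0"
  shows "green (glue G1 e1 G2 e2 f2) (e1, e2) z (e1, e2) = 1 / (F1 + F2 - F\<nu>)"
proof -
  interpret G1: bounded_degree_graph G1 D by fact
  interpret G2: bounded_degree_graph G2 D by fact
  interpret G: bounded_degree_graph "glue G1 e1 G2 e2 f2" "D + D"
    using bounded_degree_glue[OF G1 G2 e2 f2] .
  have zD: "norm z > D" using z by simp
  \<comment> \<open>Chosen such that \<open>h e1\<close> is the claimed value; the equation at \<open>e1\<close> then reads
    \<open>\<kappa> = 1 - (F2 - F\<nu>) * h e1\<close>.\<close>
  define \<kappa> where "\<kappa> = F1 / (F1 + F2 - F\<nu>)"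
  define h where "h x = \<kappa> * green G1 e1 F\<nu> x" for x
  define r where "r = (\<lambda>x. if x = e1 then e2 else f2)"
  define F where "F = (\<lambda>x. if x = e1 then F2 else F\<nu>)"
  define u where "u = (\<lambda>(x, y). h x * F x * green G2 (r x) z y)"
  have h_root: "h e1 = 1 / (F1 + F2 - F\<nu>)"
    using F1 nz by (simp add: h_def \<kappa>_def)
  have h_eq: "h x * F x = of_bool (x = e1) + nbr_sum G1 h x" for x
  proof -
    have "F\<nu> * h x = \<kappa> * (F\<nu> * green G1 e1 F\<nu> x)" by (simp add: h_def)
    also have "\<dots> = \<kappa> * of_bool (x = e1) + nbr_sum G1 h x"
      unfolding G1.green_eq[OF F\<nu>(3)]
      by (simp add: nbr_sum_def h_def[abs_def] sum_distrib_left algebra_simps)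
    finally have *: "F\<nu> * h x = \<kappa> * of_bool (x = e1) + nbr_sum G1 h x" .
    show ?thesis
    proof (cases "x = e1")
      case True
      have "h e1 * F2 = 1 + (F\<nu> * h e1 - \<kappa>)"
        using nz unfolding h_root \<kappa>_def by (simp add: divide_simps)
      then show ?thesis using * True by (simp add: F_def)
    next
      case False
      then show ?thesis using * by (simp add: F_def mult.commute)
    qed
  qed
  have u_anchor: "u (x, r x) = h x" for x
    using F2 F\<nu> by (simp add: u_def F_def r_def)
  have "u (e1, e2) = green (glue G1 e1 G2 e2 f2) (e1, e2) z (e1, e2)"
  proof (rule G.green_unique)
    show "real (D + D) < norm z" using z by simp
    show "(e1, e2) \<in> verts (glue G1 e1 G2 e2 f2)" using e1 e2 by (simp add: glue_def)
  next
    let ?B = "norm \<kappa> * (1 / (norm F\<nu> - D)) * (norm F2 + norm F\<nu>) * (1 / (norm z - D))"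
    fix p assume "p \<in> verts (glue G1 e1 G2 e2 f2)"
    obtain x y where p: "p = (x, y)" by (cases p)
    have "norm (u p) = norm \<kappa> * norm (green G1 e1 F\<nu> x) * norm (F x) * norm (green G2 (r x) z y)"
      by (simp add: p u_def h_def norm_mult)
    also have "\<dots> \<le> ?B"
      by (intro mult_mono G1.norm_green_le G2.norm_green_le F\<nu> zD order_refl mult_nonneg_nonneg)
        (use zD F\<nu>(3) in \<open>auto simp: F_def\<close>)
    finally show "norm (u p) \<le> ?B" .
  next
    fix p assume "p \<in> verts (glue G1 e1 G2 e2 f2)"
    then obtain x y where p: "p = (x, y)" "x \<in> verts G1" "y \<in> verts G2"
      by (auto simp: glue_def)
    have "z * u p = h x * F x * (z * green G2 (r x) z y)"
      by (simp add: p u_def)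
    also have "\<dots> = h x * F x * of_bool (y = r x) + nbr_sum G2 (\<lambda>y'. u (x, y')) y"
      unfolding G2.green_eq[OF zD]
      by (simp add: nbr_sum_def u_def sum_distrib_left algebra_simps)
    also have "h x * F x * of_bool (y = r x)
        = of_bool (p = (e1, e2)) + (if y = r x then nbr_sum G1 h x else 0)"
      by (simp add: h_eq p r_def)
    also have "h = (\<lambda>x'. u (x', r x'))" by (simp add: u_anchor fun_eq_iff)
    finally show "z * u p = of_bool (p = (e1, e2)) + nbr_sum (glue G1 e1 G2 e2 f2) u p"
      unfolding p(1) nbr_sum_glue[OF G1 G2 p(2,3)] r_def by (simp only: add.assoc)
  qed
  then show ?thesis
    using u_anchor[of e1] h_root by (simp add: r_def)
qed

section \<open>Reciprocal Cauchy transforms of the glued graph\<close>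

lemma eventually_norm_gt: "\<forall>\<^sub>F z :: complex in at_infinity. norm z > B"
  unfolding eventually_at_infinity by (intro exI[of _ "B + 1"]) auto

context bounded_degree_graph
begin

lemma spectral_distribution_support:
  assumes "e \<in> verts G" "spectral_distribution G e \<mu>"
  shows "AE x in \<mu>. \<bar>x\<bar> \<le> D"
proof -
  have \<mu>: "real_distribution \<mu>" "\<And>n. integrable \<mu> (\<lambda>x. x ^ n)"
      "\<And>n. (\<integral>x. x ^ n \<partial>\<mu>) = walk_count G e n e"
    using assms by (simp_all add: spectral_distribution_iff)
  interpret real_distribution \<mu> by fact
  show ?thesis
    by (rule AE_abs_le_of_moments[OF _ \<mu>(2)]) (simp_all only: \<mu>(3) walk_count_le of_nat_0_le_iff)
qed

lemma moment_series_sums_cauchy_transform: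
  assumes "e \<in> verts G" "spectral_distribution G e \<mu>" "norm z > D"
  shows "(\<lambda>n. complex_of_real (\<integral>x. x ^ n \<partial>\<mu>) / z ^ (n + 1)) sums cauchy_transform \<mu> z"
proof -
  interpret real_distribution \<mu>
    using assms by (simp add: spectral_distribution_iff)
  show ?thesis
    by (rule sums_cauchy_transform[OF _ spectral_distribution_support[OF assms(1,2)] assms(3)]) simp
qed

lemma cauchy_transform_eq_green:
  assumes "e \<in> verts G" "spectral_distribution G e \<mu>" "norm z > D"
  shows "cauchy_transform \<mu> z = green G e z e"
proof -
  have "\<And>n. (\<integral>x. x ^ n \<partial>\<mu>) = walk_count G e n e"
    using assms by (simp add: spectral_distribution_iff)
  then show ?thesis
    using moment_series_sums_cauchy_transform[OF assms] green_sums[OF assms(3)]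
    by (simp add: sums_unique2)
qed

lemma recip_cauchy_eq_green:
  assumes "e \<in> verts G" "spectral_distribution G e \<mu>" "norm z > D"
  shows "recip_cauchy \<mu> z = 1 / green G e z e"
  using cauchy_transform_eq_green[OF assms] by (simp add: recip_cauchy_def)

text \<open>The resolvent equation at the root gives \<open>z * G z - 1 = O(1 / |z|)\<close>.\<close>

lemma recip_cauchy_asymp:
  assumes e: "e \<in> verts G" and \<mu>: "spectral_distribution G e \<mu>"
  shows "((\<lambda>z. recip_cauchy \<mu> z / z) \<longlongrightarrow> 1) at_infinity"
proof -
  have "((\<lambda>z. z * cauchy_transform \<mu> z - 1) \<longlongrightarrow> 0) at_infinity"
  proof (rule Lim_null_comparison)
    show "\<forall>\<^sub>F z in at_infinity. norm (z * cauchy_transform \<mu> z - 1) \<le> D * (1 / (norm z - D))"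
      using eventually_norm_gt[of "real D"]
    proof eventually_elim
      case (elim z)
      have "z * cauchy_transform \<mu> z - 1 = nbr_sum G (green G e z) e"
        using green_eq[OF elim, of e e] by (simp add: cauchy_transform_eq_green[OF e \<mu> elim])
      then show ?case
        using norm_nbr_sum_le[of "green G e z" "1 / (norm z - D)" e] norm_green_le[OF elim] elim
        by simp
    qed
    have "filterlim (\<lambda>z::complex. - real D + norm z) at_top at_infinity"
      by (rule filterlim_tendsto_add_at_top[OF tendsto_const filterlim_norm_at_top])
    then have "((\<lambda>z::complex. inverse (- real D + norm z)) \<longlongrightarrow> 0) at_infinity"
      by (rule filterlim_compose[OF tendsto_inverse_0_at_top[OF filterlim_ident]])
    then have "((\<lambda>z::complex. D * inverse (- real D + norm z)) \<longlongrightarrow> real D * 0) at_infinity"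
      by (intro tendsto_mult tendsto_const)
    then show "((\<lambda>z::complex. D * (1 / (norm z - D))) \<longlongrightarrow> 0) at_infinity"
      by (simp add: divide_inverse)
  qed
  then have "((\<lambda>z. z * cauchy_transform \<mu> z) \<longlongrightarrow> 1) at_infinity"
    by (rule LIM_zero_cancel)
  then have "((\<lambda>z. 1 / (z * cauchy_transform \<mu> z)) \<longlongrightarrow> 1 / 1) at_infinity"
    by (intro tendsto_divide tendsto_const) auto
  then show ?thesis by (simp add: recip_cauchy_def mult.commute)
qed

end

lemma asymp_id_imp_filterlim_at_infinity:
  fixes f :: "complex \<Rightarrow> complex"
  assumes "((\<lambda>z. f z / z) \<longlongrightarrow> 1) at_infinity"
  shows "filterlim f at_infinity at_infinity"
proof -
  have "filterlim (\<lambda>z. f z / z * z) at_infinity at_infinity"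
    by (rule tendsto_mult_filterlim_at_infinity[OF assms]) (auto intro: filterlim_ident)
  moreover have "\<forall>\<^sub>F z :: complex in at_infinity. f z / z * z = f z"
    unfolding eventually_at_infinity by (intro exI[of _ 1]) auto
  ultimately show ?thesis
    using filterlim_cong[OF refl refl] by fast
qed

text \<open>All three reciprocal transforms are asymptotic to \<open>z\<close>, and therefore so is the right-hand side.
  Thus for large \<open>|z|\<close> nothing vanishes, the point \<open>F\<^bsub>\<nu>2\<^esub> z\<close> lies in the domain of convergence of
  the first graph, and \<open>green_glue\<close> applies.\<close>

lemma recip_cauchy_glue_at_infinity:
  assumes G1: "bounded_degree_graph G1 D" and G2: "bounded_degree_graph G2 D"
    and e1: "e1 \<in> verts G1" and e2: "e2 \<in> verts G2" and f2: "f2 \<in> verts G2"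
    and \<mu>1: "spectral_distribution G1 e1 \<mu>1"
    and \<mu>2: "spectral_distribution G2 e2 \<mu>2"
    and \<nu>2: "spectral_distribution G2 f2 \<nu>2"
    and \<mu>: "spectral_distribution (glue G1 e1 G2 e2 f2) (e1, e2) \<mu>"
  shows "\<forall>\<^sub>F z in at_infinity. recip_cauchy \<mu> z
    = recip_cauchy \<mu>1 (recip_cauchy \<nu>2 z) + recip_cauchy \<mu>2 z - recip_cauchy \<nu>2 z"
proof -
  interpret G1: bounded_degree_graph G1 D by fact
  interpret G2: bounded_degree_graph G2 D by fact
  interpret G: bounded_degree_graph "glue G1 e1 G2 e2 f2" "D + D"
    using bounded_degree_glue[OF G1 G2 e2 f2] .
  have root: "(e1, e2) \<in> verts (glue G1 e1 G2 e2 f2)"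
    using e1 e2 by (simp add: glue_def)
  let ?F1 = "recip_cauchy \<mu>1" and ?F2 = "recip_cauchy \<mu>2" and ?F\<nu> = "recip_cauchy \<nu>2"
  note as1 = G1.recip_cauchy_asymp[OF e1 \<mu>1]
    and as2 = G2.recip_cauchy_asymp[OF e2 \<mu>2]
    and as\<nu> = G2.recip_cauchy_asymp[OF f2 \<nu>2]
  note inf\<nu> = asymp_id_imp_filterlim_at_infinity[OF as\<nu>]
  have as1\<nu>: "((\<lambda>z. ?F1 (?F\<nu> z) / ?F\<nu> z) \<longlongrightarrow> 1) at_infinity"
    by (rule filterlim_compose[OF as1 inf\<nu>])
  have "((\<lambda>z. ?F1 (?F\<nu> z) / ?F\<nu> z * (?F\<nu> z / z) + ?F2 z / z - ?F\<nu> z / z) \<longlongrightarrow> 1 * 1 + 1 - 1) at_infinity"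
    by (intro tendsto_intros as1\<nu> as2 as\<nu>)
  then have "\<forall>\<^sub>F z in at_infinity.
      ?F1 (?F\<nu> z) / ?F\<nu> z * (?F\<nu> z / z) + ?F2 z / z - ?F\<nu> z / z \<noteq> 0"
    by (rule tendsto_imp_eventually_ne) simp
  moreover have "\<forall>\<^sub>F z in at_infinity. ?F1 (?F\<nu> z) / ?F\<nu> z \<noteq> 0"
      "\<forall>\<^sub>F z in at_infinity. ?F2 z / z \<noteq> 0" "\<forall>\<^sub>F z in at_infinity. ?F\<nu> z / z \<noteq> 0"
    by (rule tendsto_imp_eventually_ne[OF as1\<nu>] tendsto_imp_eventually_ne[OF as2]
        tendsto_imp_eventually_ne[OF as\<nu>]; simp)+
  moreover have "\<forall>\<^sub>F z in at_infinity. norm (?F\<nu> z) > D"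
    by (rule eventually_compose_filterlim[OF eventually_norm_gt inf\<nu>])
  moreover have "\<forall>\<^sub>F z :: complex in at_infinity. norm z > 2 * D"
    by (rule eventually_norm_gt)
  ultimately show ?thesis
  proof eventually_elim
    case (elim z)
    have zD: "norm z > D" and zDD: "norm z > real (D + D)" using elim by simp_all
    have "z \<noteq> 0" "?F\<nu> z \<noteq> 0" using elim by auto
    have F: "?F1 (?F\<nu> z) = 1 / green G1 e1 (?F\<nu> z) e1"
      "?F2 z = 1 / green G2 e2 z e2" "?F\<nu> z = 1 / green G2 f2 z f2"
      using elim by (intro G1.recip_cauchy_eq_green[OF e1 \<mu>1] G2.recip_cauchy_eq_green[OF e2 \<mu>2 zD]
        G2.recip_cauchy_eq_green[OF f2 \<nu>2 zD]; simp)+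
    have nz: "green G1 e1 (?F\<nu> z) e1 \<noteq> 0" "green G2 e2 z e2 \<noteq> 0" "green G2 f2 z f2 \<noteq> 0"
      using F elim by auto
    have "?F1 (?F\<nu> z) / ?F\<nu> z * (?F\<nu> z / z) + ?F2 z / z - ?F\<nu> z / z
        = (?F1 (?F\<nu> z) + ?F2 z - ?F\<nu> z) / z"
      using \<open>?F\<nu> z \<noteq> 0\<close> by (simp add: add_divide_distrib diff_divide_distrib)
    then have "?F1 (?F\<nu> z) + ?F2 z - ?F\<nu> z \<noteq> 0" using elim by auto
    then have "green (glue G1 e1 G2 e2 f2) (e1, e2) z (e1, e2) = 1 / (?F1 (?F\<nu> z) + ?F2 z - ?F\<nu> z)"
      using elim by (intro green_glue[OF G1 G2 e1 e2 f2 _ F(1) nz(1) F(2) nz(2) F(3) nz(3)]) simp_all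
    then show ?case
      by (simp add: G.recip_cauchy_eq_green[OF root \<mu> zDD])
  qed
qed

text \<open>Analytic continuation: the right-hand side is defined and holomorphic on the whole upper
  half-plane because \<open>recip_cauchy \<nu>2\<close> maps it into itself.\<close>

lemma recip_cauchy_eq_upper_half_plane:
  assumes "real_distribution \<mu>" "real_distribution \<mu>1" "real_distribution \<mu>2" "real_distribution \<nu>2"
    and inf: "\<forall>\<^sub>F z in at_infinity. recip_cauchy \<mu> z
      = recip_cauchy \<mu>1 (recip_cauchy \<nu>2 z) + recip_cauchy \<mu>2 z - recip_cauchy \<nu>2 z"
    and z: "0 < Im z"
  shows "recip_cauchy \<mu> z
    = recip_cauchy \<mu>1 (recip_cauchy \<nu>2 z) + recip_cauchy \<mu>2 z - recip_cauchy \<nu>2 z"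
proof -
  let ?H = "{z. 0 < Im z}"
  note hol = real_distribution.holomorphic_recip_cauchy
  from inf obtain b where b: "\<And>z. b \<le> norm z \<Longrightarrow> recip_cauchy \<mu> z
      = recip_cauchy \<mu>1 (recip_cauchy \<nu>2 z) + recip_cauchy \<mu>2 z - recip_cauchy \<nu>2 z"
    unfolding eventually_at_infinity by blast
  show ?thesis
  proof (rule analytic_continuation_open[where s = "{z. \<bar>b\<bar> < Im z}" and s' = ?H
        and f = "recip_cauchy \<mu>"
        and g = "\<lambda>z. recip_cauchy \<mu>1 (recip_cauchy \<nu>2 z) + recip_cauchy \<mu>2 z - recip_cauchy \<nu>2 z"])
    show "open {z. \<bar>b\<bar> < Im z}" "open ?H" by (rule open_halfspace_Im_gt)+
    have "\<i> * complex_of_real (\<bar>b\<bar> + 1) \<in> {z. \<bar>b\<bar> < Im z}" by simp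
    then show "{z. \<bar>b\<bar> < Im z} \<noteq> {}" by blast
    show "connected ?H" by (intro convex_connected convex_halfspace_Im_gt)
    show "{z. \<bar>b\<bar> < Im z} \<subseteq> ?H" by auto
    show "recip_cauchy \<mu> holomorphic_on ?H" by (rule hol) fact
    have "(recip_cauchy \<mu>1 \<circ> recip_cauchy \<nu>2) holomorphic_on ?H"
      by (rule holomorphic_on_compose_gen[OF hol hol])
        (use assms real_distribution.Im_recip_cauchy_pos in auto)
    then show "(\<lambda>z. recip_cauchy \<mu>1 (recip_cauchy \<nu>2 z) + recip_cauchy \<mu>2 z - recip_cauchy \<nu>2 z)
        holomorphic_on ?H"
      using hol assms(3,4) unfolding o_def by (intro holomorphic_intros) auto
    show "recip_cauchy \<mu> z
        = recip_cauchy \<mu>1 (recip_cauchy \<nu>2 z) + recip_cauchy \<mu>2 z - recip_cauchy \<nu>2 z"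
      if "z \<in> {z. \<bar>b\<bar> < Im z}" for z
      by (rule b) (use that abs_Im_le_cmod[of z] in auto)
  qed (use z in simp)
qed

lemma c_monotone_conv_eqI:
  assumes \<mu>: "real_distribution \<mu>"
    and eq: "\<And>z. 0 < Im z \<Longrightarrow> recip_cauchy \<mu> z
      = recip_cauchy \<mu>1 (recip_cauchy \<nu>2 z) + recip_cauchy \<mu>2 z - recip_cauchy \<nu>2 z"
  shows "c_monotone_conv \<mu>1 \<nu>2 \<mu>2 = \<mu>"
  unfolding c_monotone_conv_def
proof (rule the_equality)
  fix \<mu>'
  assume *: "real_distribution \<mu>' \<and> (\<forall>z. 0 < Im z \<longrightarrow> recip_cauchy \<mu>' z
    = recip_cauchy \<mu>1 (recip_cauchy \<nu>2 z) + recip_cauchy \<mu>2 z - recip_cauchy \<nu>2 z)"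
  show "\<mu>' = \<mu>"
  proof (rule cauchy_transform_unique)
    fix z assume "0 < Im z"
    then have "recip_cauchy \<mu>' z = recip_cauchy \<mu> z" using * eq by simp
    then show "cauchy_transform \<mu>' z = cauchy_transform \<mu> z"
      by (simp add: recip_cauchy_def)
  qed (use * \<mu> in auto)
qed (use \<mu> eq in auto)

theorem proposition4p1:
  fixes G1 :: "('v1, 'e1) multigraph" and e1 f1 :: 'v1
    and G2 :: "('v2, 'e2) multigraph" and e2 f2 :: 'v2
    and \<mu>1 \<mu>2 \<nu>2 \<mu> :: "real measure"
  assumes "birooted_graph G1 e1 f1"
    and "birooted_graph G2 e2 f2"
    and "spectral_distribution G1 e1 \<mu>1"
    and "spectral_distribution G2 e2 \<mu>2"
    and "spectral_distribution G2 f2 \<nu>2"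
    and "\<mu> = c_monotone_conv \<mu>1 \<nu>2 \<mu>2"
  shows "spectral_distribution (glue G1 e1 G2 e2 f2) (e1, e2) \<mu> \<and>
    (\<forall>z. Im z > 0 \<longrightarrow>
       recip_cauchy \<mu> z
         = recip_cauchy \<mu>1 (recip_cauchy \<nu>2 z) + recip_cauchy \<mu>2 z - recip_cauchy \<nu>2 z) \<and>
    (\<forall>\<^sub>F z in at_infinity.
       recip_cauchy \<mu> z
         = recip_cauchy \<mu>1 (recip_cauchy \<nu>2 z) + recip_cauchy \<mu>2 z - recip_cauchy \<nu>2 z) \<and>
    (\<forall>\<rho>\<in>{\<mu>1, \<mu>2, \<nu>2, \<mu>}. \<forall>\<^sub>F z in at_infinity.
       (\<lambda>n. complex_of_real (\<integral>x. x ^ n \<partial>\<rho>) / z ^ (n + 1)) sums cauchy_transform \<rho> z) \<and>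
    (\<forall>n. (\<integral>x. x ^ n \<partial>\<mu>)
       = real (card {p. walk (glue G1 e1 G2 e2 f2) (e1, e2) p (e1, e2) \<and> length p = n}))"
proof -
  interpret B1: birooted_graph G1 e1 f1 by fact
  interpret B2: birooted_graph G2 e2 f2 by fact
  obtain D1 D2 where "bounded_degree_graph G1 D1" "bounded_degree_graph G2 D2"
    using ulf_imp_bounded_degree[OF B1.ulf_graph_axioms] ulf_imp_bounded_degree[OF B2.ulf_graph_axioms]
    by metis
  then have G1: "bounded_degree_graph G1 (max D1 D2)" and G2: "bounded_degree_graph G2 (max D1 D2)"
    using bounded_degree_graph_mono max.cobounded1 max.cobounded2 by blast+
  define D where "D = max D1 D2"
  interpret G1: bounded_degree_graph G1 D using G1 by (simp add: D_def)
  interpret G2: bounded_degree_graph G2 D using G2 by (simp add: D_def)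
  note roots = B1.root_e B2.root_e B2.root_f
  let ?G = "glue G1 e1 G2 e2 f2"
  interpret G: bounded_degree_graph ?G "D + D"
    using bounded_degree_glue[OF G1.bounded_degree_graph_axioms G2.bounded_degree_graph_axioms roots(2,3)] .
  have root: "(e1, e2) \<in> verts ?G" using roots by (simp add: glue_def)
  \<comment> \<open>The spectral distribution exists independently of the convolution; uniqueness identifies them.\<close>
  obtain \<mu>0 where \<mu>0: "spectral_distribution ?G (e1, e2) \<mu>0"
    using G.exists_spectral_distribution[OF root] by blast
  have dist: "real_distribution \<mu>0" "real_distribution \<mu>1" "real_distribution \<mu>2" "real_distribution \<nu>2"
    using \<mu>0 assms(3-5) by (simp_all add: spectral_distribution_def)
  note inf = recip_cauchy_glue_at_infinity[OF G1.bounded_degree_graph_axioms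
      G2.bounded_degree_graph_axioms roots assms(3-5) \<mu>0]
  note upper = recip_cauchy_eq_upper_half_plane[OF dist inf]
  have \<mu>: "\<mu> = \<mu>0"
    unfolding assms(6) by (rule c_monotone_conv_eqI[OF dist(1) upper])
  have "\<forall>\<^sub>F z in at_infinity.
      (\<lambda>n. complex_of_real (\<integral>x. x ^ n \<partial>\<rho>) / z ^ (n + 1)) sums cauchy_transform \<rho> z"
    if "\<rho> \<in> {\<mu>1, \<mu>2, \<nu>2, \<mu>0}" for \<rho>
    using eventually_norm_gt[of "real (D + D)"]
  proof eventually_elim
    case (elim z)
    then have "norm z > real D" by simp
    then show ?case
      using that elim G1.moment_series_sums_cauchy_transform[OF roots(1) assms(3)]
        G2.moment_series_sums_cauchy_transform[OF roots(2) assms(4)]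
        G2.moment_series_sums_cauchy_transform[OF roots(3) assms(5)]
        G.moment_series_sums_cauchy_transform[OF root \<mu>0]
      by blast
  qed
  moreover have "(\<integral>x. x ^ n \<partial>\<mu>0)
      = real (card {p. walk ?G (e1, e2) p (e1, e2) \<and> length p = n})" for n
    using \<mu>0 G.finite_card_walks[OF root root, of n] by (simp add: G.spectral_distribution_iff[OF root])
  ultimately show ?thesis
    unfolding \<mu> using \<mu>0 inf upper by blast
qed

end
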